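(* Let $\mathbf{S}_n=\mathbf{X}_1+\dots+\mathbf{X}_n$ be a random walk in $\mathbb{R}^d$ with i.i.d. increments $\mathbf{X},\mathbf{X}_1,\mathbf{X}_2,\dots$ of the form $\mathbf{X}=R\boldsymbol{\Theta}$, where $\boldsymbol{\Theta}$ fulfils assumption (A2') (written out in the context) and the ellipsoid $\Omega=\Lambda(\mathbb{S}^{d-1})$ is defined by the linear transformation $\Lambda(\mathbf{x})=A\mathbf{x}$, where $A$ is a diagonal $d\times d$ matrix with $a_{k,k}>0$ for all $k=1,\dots,d$. Furthermore, assume that $R$ follows a Weibull distribution with parameter $\beta\in(0,1)$. Then the quota share reinsurance strategy defined by the matrix $Q=\bigl(\min_{1\le j\le d}a_{j,j}\bigr)A^{-1}$ yields the inequality $$\lim_{n\to\infty}\frac{\log(\mathbb{P}(\|\mathbf{S}_n/n\|_2>a))}{h(n)}\ \ge\ \lim_{n\to\infty}\frac{\log(\mathbb{P}(\|Q\mathbf{S}_n/n\|_2>a))}{h(n)}\qquad( * )$$ for any $a>0$, and $Q$ minimises the right-hand side of $( * )$ over all strategies, i.e. over all matrices in the set $\mathcal{Q}$ defined in the context. The minimiser is unique under the additional condition that the premium $p(Q)$ is also minimised (i.e. among all strategies in $\mathcal{Q}$ minimising the right-hand side of $( * )$, $Q$ is the unique one with the smallest premium).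
   Context: $\|\cdot\|_2$ is the Euclidean norm on $\mathbb{R}^d$ and $\mathbb{S}^{d-1}=\{\mathbf{x}\in\mathbb{R}^d:\|\mathbf{x}\|_2=1\}$. Weibull with parameter $\beta\in(0,1)$: $R\ge 0$ and $\mathbb{P}(R>x)=e^{-\kappa x^\beta}$, $x\ge0$, for some constant $\kappa>0$; the function $h$ is $h(x)=\kappa x^\beta$, so that $-\log\mathbb{P}(R>x)\sim h(x)$ as $x\to\infty$. (A2'): $\boldsymbol{\Theta}$ is a $d$-dimensional random vector taking values in the ellipsoid $\Omega$ centred at the origin, with $\mathbb{E}(R\boldsymbol{\Theta})=\mathbf{0}$. For every (measurable) set $S\subset\Omega$ with positive Lebesgue (surface) measure, $\mathbb{P}(\boldsymbol{\Theta}\in S)>0$ and $\lim_{x\to\infty}\mathbb{P}(\boldsymbol{\Theta}\in S\mid R>x)=\mathbb{P}(\boldsymbol{\Theta}\in S)$. Strategies: a quota share reinsurance strategy of the ceding company is a diagonal $d\times d$ matrix with diagonal entries $q_{j,j}\in(0,1]$ for all $j=1,\dots,d$ and $q_{k,k}=1$ for at least one index $k\in\{1,\dots,d\}$ (the ceding company pays the share $q_{k,k}X^k$ of component $k$). $\mathcal{Q}$ denotes the set of all such matrices. Premium: given a fixed vector $\mathbf{p}=(p_1,\dots,p_d)^T$ with positive components, the premium of strategy $Q$ is $p(Q)=\sum_{j=1}^d(1-q_{j,j})p_j$. *)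

theory Defs
  imports "HOL-Probability.Probability"
begin

text \<open>
  The \<open>k\<close>-dimensional Hausdorff (outer) measure, normalised to agree with \<open>k\<close>-dimensional
  volume. For \<open>k = CARD('n) - 1\<close> it is the surface measure on hypersurfaces of \<open>real ^ 'n\<close>.
  The power is the natural-number one, so a nonempty covering set contributes
  \<open>1\<close> when \<open>k = 0\<close>; the empty set has to be treated separately for that reason.
\<close>

definition hausdorff_premeasure :: "nat \<Rightarrow> real \<Rightarrow> 'a::metric_space set \<Rightarrow> ennreal" where
  "hausdorff_premeasure k \<delta> S =
     (INF U \<in> {U :: nat \<Rightarrow> 'a set. S \<subseteq> (\<Union>i. U i) \<and> (\<forall>i. bounded (U i) \<and> diameter (U i) \<le> \<delta>)}.
        \<Sum>i. ennreal (if U i = {} then 0 else unit_ball_vol (real k) * (diameter (U i) / 2) ^ k))"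

definition hausdorff_measure :: "nat \<Rightarrow> 'a::metric_space set \<Rightarrow> ennreal" where
  "hausdorff_measure k S = (SUP \<delta> \<in> {0<..}. hausdorff_premeasure k \<delta> S)"

definition surface_measure :: "(real ^ 'n::finite) set \<Rightarrow> ennreal" where
  "surface_measure S = hausdorff_measure (CARD('n) - 1) S"

definition weibull_exponent :: "real \<Rightarrow> real \<Rightarrow> real \<Rightarrow> real" where
  "weibull_exponent \<kappa> \<beta> x = \<kappa> * x powr \<beta>"

definition weibull_distributed :: "'a measure \<Rightarrow> real \<Rightarrow> real \<Rightarrow> ('a \<Rightarrow> real) \<Rightarrow> bool" where
  "weibull_distributed M \<kappa> \<beta> R \<longleftrightarrow>
     R \<in> borel_measurable M \<and>
     (AE \<omega> in M. 0 \<le> R \<omega>) \<and>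
     (\<forall>x\<ge>0. \<P>(\<omega> in M. R \<omega> > x) = exp (- weibull_exponent \<kappa> \<beta> x))"

definition angular_assumption ::
    "'a measure \<Rightarrow> ('a \<Rightarrow> real) \<Rightarrow> ('a \<Rightarrow> real ^ 'n::finite) \<Rightarrow> (real ^ 'n) set \<Rightarrow> bool" where
  "angular_assumption M R \<Theta> \<Omega> \<longleftrightarrow>
     \<Theta> \<in> borel_measurable M \<and>
     (AE \<omega> in M. \<Theta> \<omega> \<in> \<Omega>) \<and>
     has_bochner_integral M (\<lambda>\<omega>. R \<omega> *\<^sub>R \<Theta> \<omega>) 0 \<and>
     (\<forall>S \<in> sets borel. S \<subseteq> \<Omega> \<longrightarrow> surface_measure S > 0 \<longrightarrow>
        \<P>(\<omega> in M. \<Theta> \<omega> \<in> S) > 0 \<and>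
        ((\<lambda>x. \<P>(\<omega> in M. \<Theta> \<omega> \<in> S \<bar> R \<omega> > x)) \<longlongrightarrow> \<P>(\<omega> in M. \<Theta> \<omega> \<in> S)) at_top)"

definition diagonal_mat :: "real ^ 'n ^ 'n::finite \<Rightarrow> bool" where
  "diagonal_mat A \<longleftrightarrow> (\<forall>i j. i \<noteq> j \<longrightarrow> A $ i $ j = 0)"

definition quota_share_strategies :: "(real ^ 'n ^ 'n::finite) set" where
  "quota_share_strategies =
     {Q. diagonal_mat Q \<and> (\<forall>j. 0 < Q $ j $ j \<and> Q $ j $ j \<le> 1) \<and> (\<exists>k. Q $ k $ k = 1)}"

definition premium :: "real ^ 'n \<Rightarrow> real ^ 'n ^ 'n::finite \<Rightarrow> real" where
  "premium p Q = (\<Sum>j\<in>UNIV. (1 - Q $ j $ j) * p $ j)"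

text \<open>The increments of the walk are numbered from 1; \<open>X 0\<close> plays no role.\<close>

definition random_walk :: "(nat \<Rightarrow> 'a \<Rightarrow> real ^ 'n::finite) \<Rightarrow> nat \<Rightarrow> 'a \<Rightarrow> real ^ 'n" where
  "random_walk X n \<omega> = (\<Sum>i=1..n. X i \<omega>)"

definition log_prob_ratio ::
    "'a measure \<Rightarrow> (real \<Rightarrow> real) \<Rightarrow> (nat \<Rightarrow> 'a \<Rightarrow> real ^ 'n::finite) \<Rightarrow> real \<Rightarrow> nat \<Rightarrow> real" where
  "log_prob_ratio M h Y a n = ln \<P>(\<omega> in M. norm (Y n \<omega> /\<^sub>R real n) > a) / h (real n)"

text \<open>
  The limit in the large deviation statements. It is meaningful only where the sequence
  converges, which the theorem asserts separately.
\<close>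

definition log_prob_rate ::
    "'a measure \<Rightarrow> (real \<Rightarrow> real) \<Rightarrow> (nat \<Rightarrow> 'a \<Rightarrow> real ^ 'n::finite) \<Rightarrow> real \<Rightarrow> real" where
  "log_prob_rate M h Y a = lim (log_prob_ratio M h Y a)"

definition retained_walk ::
    "(nat \<Rightarrow> 'a \<Rightarrow> real ^ 'n::finite) \<Rightarrow> real ^ 'n ^ 'n \<Rightarrow> nat \<Rightarrow> 'a \<Rightarrow> real ^ 'n" where
  "retained_walk X Q n \<omega> = Q *v random_walk X n \<omega>"

definition rate_minimising_strategy ::
    "'a measure \<Rightarrow> (real \<Rightarrow> real) \<Rightarrow> (nat \<Rightarrow> 'a \<Rightarrow> real ^ 'n::finite) \<Rightarrow> real
       \<Rightarrow> real ^ 'n ^ 'n \<Rightarrow> bool" where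
  "rate_minimising_strategy M h X a =
     is_arg_min (\<lambda>Q. log_prob_rate M h (retained_walk X Q) a) (\<lambda>Q. Q \<in> quota_share_strategies)"

end

theory Submission
  imports Defs "HOL-Real_Asymp.Real_Asymp"
begin

text \<open>
  For a diagonal matrix \<open>D\<close> with positive entries let \<open>m = max\<^sub>j d\<^sub>j\<^sub>j a\<^sub>j\<^sub>j\<close> be the longest semi-axis of the
  ellipsoid \<open>D \<Omega>\<close>. The rate of \<open>D S\<^sub>n\<close> is \<open>- (a / m)\<^sup>\<beta>\<close>, so a strategy minimises the rate iff it
  minimises \<open>m\<close>. Some entry of a strategy is 1, whence \<open>m \<ge> min\<^sub>j a\<^sub>j\<^sub>j\<close>, with equality iff
  \<open>q\<^sub>j\<^sub>j \<le> min\<^sub>i a\<^sub>i\<^sub>i / a\<^sub>j\<^sub>j\<close> for all \<open>j\<close>; the premium is smallest when all these are equalities.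

  The upper bound for the rate reduces to finitely many directions. In each of them the steps are
  truncated at the level \<open>c\<close> to be exceeded and the exponential Markov inequality is applied with the
  parameter \<open>s m\<^sup>-\<^sup>\<beta> c\<^sup>\<beta>\<^sup>-\<^sup>1\<close>, \<open>s < \<kappa>\<close>; because \<open>\<beta> < 1\<close>, the truncated exponential moments are dominated by
  \<open>E exp (s R\<^sup>\<beta>) < \<infinity>\<close>. The lower bound comes from one large step along the longest axis; it has the
  required probability since a cap of the ellipsoid has positive surface measure.
\<close>

section \<open>An elementary exponential bound\<close>

text \<open>In expectation at a multiple of a centred variable the linear term vanishes and only a
  weighted second moment remains. For 0 \<le> x < 1 multiply \<open>exp x * (1 - x) \<le> 1\<close>
  by 1 + x; for negative x use that (1 + x + x^2)(1 - x) = 1 - x^3 is at least 1.\<close>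

lemma exp_le_quadratic:
  fixes x :: real
  shows "exp x \<le> 1 + x + x\<^sup>2 * exp (max x 0)"
proof (cases "0 \<le> x")
  case True
  have "exp x * (1 - x\<^sup>2) \<le> 1 + x"
  proof (cases "x < 1")
    case True
    have "exp x * (1 - x) \<le> exp x * exp (- x)"
      using exp_ge_add_one_self[of "- x"] by (intro mult_left_mono) auto
    then have "exp x * (1 - x) \<le> 1" by (simp add: exp_minus)
    then have "exp x * (1 - x) * (1 + x) \<le> 1 * (1 + x)"
      using \<open>0 \<le> x\<close> by (intro mult_right_mono) auto
    then show ?thesis by (simp add: power2_eq_square algebra_simps)
  next
    case False
    then have "exp x * (1 - x\<^sup>2) \<le> 0"
      by (intro mult_nonneg_nonpos) auto
    then show ?thesis using \<open>0 \<le> x\<close> by linarith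
  qed
  then show ?thesis using True by (simp add: max_def algebra_simps)
next
  case False
  have "1 \<le> (1 + x + x\<^sup>2) * (1 - x)"
    using False by (simp add: algebra_simps power2_eq_square mult_nonpos_nonneg mult_nonneg_nonpos)
  also have "\<dots> \<le> (1 + x + x\<^sup>2) * exp (- x)"
  proof (rule mult_left_mono)
    show "1 - x \<le> exp (- x)" using exp_ge_add_one_self[of "- x"] by simp
    have "0 \<le> (1 + x / 2)\<^sup>2 + 3 / 4 * x\<^sup>2" by simp
    then show "0 \<le> 1 + x + x\<^sup>2" by (simp add: power2_eq_square algebra_simps)
  qed
  finally have "exp x \<le> 1 + x + x\<^sup>2"
    by (simp add: exp_minus field_simps)
  then show ?thesis using False by (simp add: max_def)
qed

section \<open>Positive surface measure of ellipsoid caps\<close>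

text \<open>A volume comparison: each covering set is replaced by a box with side [0, 1] in
  coordinate \<open>k\<close> and, in the others, sides of twice the diameter centred at one of its
  points. These boxes cover the slab of height 1 over the cube of half-side \<open>\<delta>\<close>,
  so Lebesgue measure in the full space bounds the sum of powers of diameters from below, uniformly
  in \<open>e\<close>.\<close>

lemma hausdorff_premeasure_projection_ge:
  fixes S :: "(real ^ 'n::finite) set"
  assumes "0 \<le> \<delta>"
    and proj: "\<And>y :: real ^ 'n. (\<And>j. j \<noteq> k \<Longrightarrow> \<bar>y $ j\<bar> \<le> \<delta>) \<Longrightarrow> \<exists>x\<in>S. \<forall>j. j \<noteq> k \<longrightarrow> x $ j = y $ j"
  shows "hausdorff_premeasure (CARD('n) - 1) e S \<ge>
    ennreal (unit_ball_vol (real (CARD('n) - 1)) * (\<delta> / 2) ^ (CARD('n) - 1))"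
  unfolding hausdorff_premeasure_def
proof (rule INF_greatest, clarify)
  fix U :: "nat \<Rightarrow> (real ^ 'n) set"
  assume cov: "S \<subseteq> (\<Union>i. U i)" and bd: "\<forall>i. bounded (U i) \<and> diameter (U i) \<le> e"
  define d where "d = CARD('n) - 1"
  define v where "v = unit_ball_vol (real d)"
  have v0: "0 < v" by (simp add: v_def)
  define r where "r i = diameter (U i)" for i
  have r0: "0 \<le> r i" for i
    unfolding r_def using bd diameter_ge_0 by blast
  define c where "c i = (SOME x. x \<in> U i)" for i
  define l where "l i = (\<chi> j. if j = k then 0 else c i $ j - r i)" for i
  define u where "u i = (\<chi> j. if j = k then 1 else c i $ j + r i)" for i
  \<comment> \<open>An empty \<open>U i\<close> must give an empty box: for \<open>d = 0\<close> its
    slab would have volume 1, whereas its term in the premeasure is 0.\<close>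
  define B where "B i = (if U i = {} then {} else cbox (l i) (u i))" for i
  define a where "a = (\<chi> j. if j = k then 0 else - \<delta>)"
  define b where "b = (\<chi> j. if j = k then 1 else \<delta>)"
  have slab: "emeasure lborel (cbox (\<chi> j. if j = k then 0 else x $ j - t) (\<chi> j. if j = k then 1 else x $ j + t))
      = ennreal ((2 * t) ^ d)" if "0 \<le> t" for t :: real and x :: "real ^ 'n"
  proof -
    let ?l = "\<chi> j. if j = k then 0 else x $ j - t" and ?u = "\<chi> j. if j = k then 1 else x $ j + t"
    have ne: "cbox ?l ?u \<noteq> {}" using that by (auto simp: interval_ne_empty_cart)
    have "measure lborel (cbox ?l ?u) = (\<Prod>j\<in>UNIV. ?u $ j - ?l $ j)"
      using content_cbox_cart[OF ne] by simp
    also have "\<dots> = (\<Prod>j\<in>UNIV - {k}. ?u $ j - ?l $ j)"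
      by (subst prod.remove[of _ k]) auto
    also have "\<dots> = (\<Prod>j\<in>UNIV - {k}. 2 * t)"
      by (intro prod.cong) auto
    also have "\<dots> = (2 * t) ^ d" by (simp add: d_def)
    finally show ?thesis
      using emeasure_lborel_cbox_finite[of ?l ?u] by (subst emeasure_eq_ennreal_measure) auto
  qed
  have sub: "cbox a b \<subseteq> (\<Union>i. B i)"
  proof
    fix y assume y: "y \<in> cbox a b"
    then have ab: "a $ j \<le> y $ j \<and> y $ j \<le> b $ j" for j by (simp add: mem_box_cart)
    have "\<bar>y $ j\<bar> \<le> \<delta>" if "j \<noteq> k" for j
      using ab[of j] that by (auto simp: a_def b_def abs_le_iff)
    then obtain x where x: "x \<in> S" "\<And>j. j \<noteq> k \<Longrightarrow> x $ j = y $ j" using proj by blast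
    then obtain i where i: "x \<in> U i" using cov by blast
    have ci: "c i \<in> U i" unfolding c_def using i by (rule someI)
    have "dist x (c i) \<le> r i" unfolding r_def using diameter_bounded_bound bd i ci by blast
    then have "\<bar>x $ j - c i $ j\<bar> \<le> r i" for j
      using component_le_norm_cart[of "x - c i" j] by (simp add: dist_norm)
    then have "l i $ j \<le> y $ j \<and> y $ j \<le> u i $ j" if "j \<noteq> k" for j
      using x(2)[OF that] that by (simp add: l_def u_def abs_le_iff) (smt (verit))
    moreover have "l i $ k \<le> y $ k \<and> y $ k \<le> u i $ k"
      using ab[of k] by (simp add: a_def b_def l_def u_def)
    ultimately have "y \<in> cbox (l i) (u i)"
      unfolding mem_box_cart by metis
    then show "y \<in> (\<Union>i. B i)" using i by (auto simp: B_def)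
  qed
  have "ennreal ((2 * \<delta>) ^ d) = emeasure lborel (cbox a b)"
    using slab[OF \<open>0 \<le> \<delta>\<close>, of 0] by (simp add: a_def b_def cong: if_cong)
  also have "\<dots> \<le> emeasure lborel (\<Union>i. B i)"
    by (rule emeasure_mono[OF sub]) (auto simp: B_def)
  also have "\<dots> \<le> (\<Sum>i. emeasure lborel (B i))"
    by (rule emeasure_subadditive_countably) (auto simp: B_def)
  also have "\<dots> = (\<Sum>i. ennreal (if U i = {} then 0 else (2 * r i) ^ d))"
    using slab[OF r0] by (intro suminf_cong) (auto simp: B_def l_def u_def)
  finally have main: "ennreal ((2 * \<delta>) ^ d) \<le> (\<Sum>i. ennreal (if U i = {} then 0 else (2 * r i) ^ d))" .
  \<comment> \<open>Premeasure terms and slab volumes differ by the fixed factor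
    \<open>v / 4 ^ d\<close>, which therefore carries over to the whole estimate.\<close>
  have scale: "v * (t / 2) ^ d = v / 4 ^ d * (2 * t) ^ d" for t :: real
  proof -
    have "(2 * t) ^ d / 4 ^ d = (t / 2) ^ d"
      by (subst power_divide[symmetric]) simp
    then show ?thesis by (metis times_divide_eq_left times_divide_eq_right)
  qed
  have "ennreal (v * (\<delta> / 2) ^ d) = ennreal (v / 4 ^ d) * ennreal ((2 * \<delta>) ^ d)"
    using v0 by (simp add: scale flip: ennreal_mult')
  also have "\<dots> \<le> ennreal (v / 4 ^ d) * (\<Sum>i. ennreal (if U i = {} then 0 else (2 * r i) ^ d))"
    using main by (rule mult_left_mono) simp
  also have "\<dots> = (\<Sum>i. ennreal (v / 4 ^ d) * ennreal (if U i = {} then 0 else (2 * r i) ^ d))"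
    by simp
  also have "\<dots> = (\<Sum>i. ennreal (if U i = {} then 0 else v * (r i / 2) ^ d))"
    using v0 by (intro suminf_cong) (simp add: scale flip: ennreal_mult')
  finally show "ennreal (unit_ball_vol (real (CARD('n) - 1)) * (\<delta> / 2) ^ (CARD('n) - 1)) \<le>
    (\<Sum>i. ennreal (if U i = {} then 0 else unit_ball_vol (real (CARD('n) - 1)) * (diameter (U i) / 2) ^ (CARD('n) - 1)))"
    unfolding v_def r_def d_def .
qed

lemma surface_measure_pos_if_projection:
  fixes S :: "(real ^ 'n::finite) set"
  assumes "0 < \<delta>"
    and proj: "\<And>y :: real ^ 'n. (\<And>j. j \<noteq> k \<Longrightarrow> \<bar>y $ j\<bar> \<le> \<delta>) \<Longrightarrow> \<exists>x\<in>S. \<forall>j. j \<noteq> k \<longrightarrow> x $ j = y $ j"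
  shows "surface_measure S > 0"
proof -
  have "0 < ennreal (unit_ball_vol (real (CARD('n) - 1)) * (\<delta> / 2) ^ (CARD('n) - 1))"
    using assms(1) by simp
  \<comment> \<open>The scale 1 is arbitrary, since the bound does not depend on it.\<close>
  also have "\<dots> \<le> hausdorff_premeasure (CARD('n) - 1) 1 S"
    using assms by (intro hausdorff_premeasure_projection_ge[of \<delta> k]) auto
  also have "\<dots> \<le> surface_measure S"
    unfolding surface_measure_def hausdorff_measure_def by (intro SUP_upper) auto
  finally show ?thesis .
qed

lemma diagonal_mat_mult_component:
  fixes A :: "real ^ 'n ^ 'n::finite"
  assumes "diagonal_mat A"
  shows "(A *v x) $ j = A $ j $ j * x $ j"
proof -
  have "(A *v x) $ j = (\<Sum>i\<in>UNIV. A $ j $ i * x $ i)" by (simp add: matrix_vector_mult_def)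
  also have "\<dots> = (\<Sum>i\<in>{j}. A $ j $ i * x $ i)"
    using assms by (intro sum.mono_neutral_right) (auto simp: diagonal_mat_def)
  finally show ?thesis by simp
qed

text \<open>Near its pole on the \<open>k\<close>-th axis the ellipsoid is a graph over the other
  coordinates, so the projection of the cap contains a cube around 0.\<close>

lemma ellipsoid_cap_surface_measure_pos:
  fixes A :: "real ^ 'n ^ 'n::finite"
  assumes A: "diagonal_mat A" "\<forall>j. 0 < A $ j $ j" and \<epsilon>: "0 < \<epsilon>" "\<epsilon> < 1"
  shows "surface_measure {\<theta> \<in> (\<lambda>x. A *v x) ` sphere 0 1. (1 - \<epsilon>) * A $ k $ k < \<theta> $ k} > 0"
proof -
  define m where "m = Min (range (\<lambda>j. A $ j $ j))"
  have m0: "0 < m" using A by (simp add: m_def)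
  have mle: "m \<le> A $ j $ j" for j by (simp add: m_def)
  define d where "d = real CARD('n)"
  have d0: "0 < d" by (simp add: d_def)
  \<comment> \<open>The cap lies above the points whose scaled coordinates have square sum at most \<open>\<epsilon> / 2\<close>.\<close>
  define \<delta> where "\<delta> = m * sqrt (\<epsilon> / (2 * d))"
  have \<delta>0: "0 < \<delta>" using m0 \<epsilon> d0 by (simp add: \<delta>_def)
  show ?thesis
  proof (rule surface_measure_pos_if_projection[OF \<delta>0, of k])
    fix y :: "real ^ 'n" assume y: "\<And>j. j \<noteq> k \<Longrightarrow> \<bar>y $ j\<bar> \<le> \<delta>"
    define s where "s = (\<Sum>j\<in>UNIV - {k}. (y $ j / A $ j $ j)\<^sup>2)"
    have "(y $ j / A $ j $ j)\<^sup>2 \<le> \<epsilon> / (2 * d)" if "j \<noteq> k" for j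
    proof -
      have "\<bar>y $ j\<bar> / A $ j $ j \<le> \<delta> / m"
        using y[OF that] mle m0 A \<delta>0 by (intro frac_le) auto
      then have "\<bar>y $ j / A $ j $ j\<bar> \<le> sqrt (\<epsilon> / (2 * d))"
        using m0 A by (simp add: \<delta>_def abs_of_pos)
      then show ?thesis by (metis real_sqrt_abs real_sqrt_le_iff)
    qed
    then have "s \<le> (\<Sum>j\<in>UNIV - {k}. \<epsilon> / (2 * d))" unfolding s_def by (intro sum_mono) auto
    also have "\<dots> \<le> (\<Sum>j\<in>(UNIV :: 'n set). \<epsilon> / (2 * d))"
      using \<epsilon> d0 by (intro sum_mono2) auto
    also have "\<dots> = \<epsilon> / 2" using d0 by (simp add: d_def)
    finally have s: "s \<le> \<epsilon> / 2" .
    have s0: "0 \<le> s" by (simp add: s_def sum_nonneg)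
    \<comment> \<open>The \<open>k\<close>-th entry completes the prescribed ones to a unit vector.
      It stays large enough, because sqrt (1 - s) \<ge> 1 - s > 1 - \<epsilon>.\<close>
    define x where "x = (\<chi> j. if j = k then sqrt (1 - s) else y $ j / A $ j $ j)"
    have "(\<Sum>j\<in>UNIV. (x $ j)\<^sup>2) = (x $ k)\<^sup>2 + (\<Sum>j\<in>UNIV - {k}. (x $ j)\<^sup>2)"
      by (intro sum.remove) auto
    also have "(\<Sum>j\<in>UNIV - {k}. (x $ j)\<^sup>2) = s"
      unfolding s_def by (intro sum.cong) (auto simp: x_def)
    also have "(x $ k)\<^sup>2 = 1 - s" using s \<epsilon> by (simp add: x_def)
    finally have "norm x = 1" by (simp add: norm_vec_def L2_set_def)
    moreover have "(1 - \<epsilon>) * A $ k $ k < (A *v x) $ k"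
    proof -
      have "1 - \<epsilon> < 1 - s" using s \<epsilon> by simp
      also have "1 - s = sqrt ((1 - s)\<^sup>2)" using s \<epsilon> by simp
      also have "\<dots> \<le> sqrt (1 - s)"
        using s s0 \<epsilon> by (intro real_sqrt_le_mono) (simp add: power2_eq_square mult_left_le)
      finally show ?thesis using A by (simp add: diagonal_mat_mult_component x_def mult.commute)
    qed
    ultimately have "A *v x \<in> {\<theta> \<in> (\<lambda>x. A *v x) ` sphere 0 1. (1 - \<epsilon>) * A $ k $ k < \<theta> $ k}"
      by auto
    moreover have "(A *v x) $ j = y $ j" if "j \<noteq> k" for j
    proof -
      have "A $ j $ j \<noteq> 0" using A by (metis less_irrefl)
      then show ?thesis using that A(1) by (simp add: diagonal_mat_mult_component x_def)
    qed
    ultimately show "\<exists>x\<in>{\<theta> \<in> (\<lambda>x. A *v x) ` sphere 0 1. (1 - \<epsilon>) * A $ k $ k < \<theta> $ k}.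
        \<forall>j. j \<noteq> k \<longrightarrow> x $ j = y $ j" by blast
  qed
qed

section \<open>Reduction of norms to finitely many directions\<close>

text \<open>By compactness finitely many balls of radius \<open>\<delta>\<close> cover the sphere.
  If \<open>u\<close> is the centre of one containing the direction w of \<open>v\<close>, then 1 -
  u \<bullet> w = (w - u) \<bullet> w is at most the distance of u and w.\<close>

lemma finite_direction_net:
  fixes \<delta> :: real
  assumes "0 < \<delta>"
  shows "\<exists>N. finite N \<and> N \<subseteq> sphere (0 :: 'b::euclidean_space) 1 \<and>
    (\<forall>v. v \<noteq> 0 \<longrightarrow> (\<exists>u\<in>N. (1 - \<delta>) * norm v \<le> u \<bullet> v))"
proof -
  have "sphere (0 :: 'b) 1 \<subseteq> (\<Union>u\<in>sphere 0 1. ball u \<delta>)"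
    using assms by (metis UN_I centre_in_ball subsetI)
  then obtain N where N: "finite N" "N \<subseteq> sphere (0 :: 'b) 1"
    "sphere 0 1 \<subseteq> (\<Union>u\<in>N. ball u \<delta>)"
    using compactE_image[OF compact_sphere, of "sphere 0 1" "\<lambda>u. ball u \<delta>"] by (metis open_ball)
  have "\<exists>u\<in>N. (1 - \<delta>) * norm v \<le> u \<bullet> v" if "v \<noteq> 0" for v :: 'b
  proof -
    let ?w = "v /\<^sub>R norm v"
    have w: "norm ?w = 1" using that by simp
    then have "?w \<in> (\<Union>u\<in>N. ball u \<delta>)" using N(3) by (metis mem_sphere_0 subsetD)
    then obtain u where u: "u \<in> N" "dist u ?w < \<delta>" by auto
    have "1 - u \<bullet> ?w = (?w - u) \<bullet> ?w"
      using w unfolding inner_diff_left norm_eq_1 by (rule ssubst[of "?w \<bullet> ?w"]) (rule refl)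
    also have "\<dots> \<le> norm (?w - u) * norm ?w" by (rule norm_cauchy_schwarz)
    also have "\<dots> \<le> \<delta>" using u(2) w by (simp add: dist_norm norm_minus_commute)
    finally have "1 - \<delta> \<le> u \<bullet> ?w" by simp
    then have "(1 - \<delta>) * norm v \<le> (u \<bullet> ?w) * norm v" by (intro mult_right_mono) auto
    also have "\<dots> = u \<bullet> v" using that by simp
    finally show ?thesis using u(1) by blast
  qed
  with N show ?thesis by blast
qed

section \<open>A truncated exponential Markov inequality\<close>

text \<open>Either some summand exceeds \<open>c\<close>, or truncation at \<open>c\<close> changes
  nothing and the exponential Markov inequality applies to the truncated summands. Their exponential
  moments are controlled by a second moment with a weight that does not depend on
  \<open>c\<close>.\<close>

lemma (in prob_space) truncated_chernoff_sum:
  fixes Z :: "'i \<Rightarrow> 'a \<Rightarrow> real"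
  assumes I: "finite I" and indep: "indep_vars (\<lambda>_. borel) Z I"
    and int: "\<And>i. i \<in> I \<Longrightarrow> integrable M (Z i)"
    and mean: "\<And>i. i \<in> I \<Longrightarrow> expectation (Z i) = 0"
    and int2: "\<And>i. i \<in> I \<Longrightarrow> integrable M (\<lambda>\<omega>. (Z i \<omega>)\<^sup>2 * exp (q * (max 0 (Z i \<omega>)) powr \<beta>))"
    and K: "\<And>i. i \<in> I \<Longrightarrow> expectation (\<lambda>\<omega>. (Z i \<omega>)\<^sup>2 * exp (q * (max 0 (Z i \<omega>)) powr \<beta>)) \<le> K"
    and \<beta>: "0 < \<beta>" "\<beta> < 1" and q: "0 < q" and c: "0 < c"
  shows "\<P>(\<omega> in M. c < (\<Sum>i\<in>I. Z i \<omega>)) \<le>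
    (\<Sum>i\<in>I. \<P>(\<omega> in M. c < Z i \<omega>)) +
    exp (- q * c powr \<beta> + real (card I) * K * (q * c powr (\<beta> - 1))\<^sup>2)"
proof -
  have Zm[measurable]: "\<And>i. i \<in> I \<Longrightarrow> Z i \<in> borel_measurable M"
    using int by (rule borel_measurable_integrable)
  \<comment> \<open>\<open>l\<close> is the slope of the chord of the concave function
    \<open>q * z powr \<beta>\<close> between 0 and \<open>c\<close>: the line \<open>l * z\<close>
    lies below the curve on this interval and meets it at \<open>c\<close>.\<close>
  define l where "l = q * c powr (\<beta> - 1)"
  have l0: "0 < l" using q c by (simp add: l_def)
  have lc: "l * c = q * c powr \<beta>"
    using c by (simp add: l_def powr_diff)
  \<comment> \<open>The cut at \<open>c\<close> keeps \<open>f\<close> bounded;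
    \<open>exp (l * Z i)\<close> itself need not be integrable, as the tails are heavier than
    exponential.\<close>
  define f where "f z = (if z \<le> c then exp (l * z) else 0)" for z
  have fm[measurable]: "f \<in> borel_measurable borel"
    unfolding f_def by measurable
  have f0: "0 \<le> f z" for z by (simp add: f_def)
  have f_bound: "f z \<le> 1 + l * z + l\<^sup>2 * (z\<^sup>2 * exp (q * (max 0 z) powr \<beta>))" for z
  proof (cases "z \<le> c")
    case True
    have "max (l * z) 0 \<le> q * (max 0 z) powr \<beta>"
    proof (cases "0 < z")
      case z: True
      have "c powr (\<beta> - 1) \<le> z powr (\<beta> - 1)"
        using True z \<beta> by (intro powr_mono2') auto
      then have "l * z \<le> q * z powr (\<beta> - 1) * z"
        using q z by (auto simp: l_def intro!: mult_right_mono mult_left_mono)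
      also have "\<dots> = q * z powr \<beta>" using z by (simp add: powr_diff)
      finally show ?thesis using z q by simp
    next
      case False
      then have "l * z \<le> 0" using l0 by (simp add: mult_nonneg_nonpos)
      then show ?thesis using q by simp
    qed
    then have "(l * z)\<^sup>2 * exp (max (l * z) 0) \<le> (l * z)\<^sup>2 * exp (q * (max 0 z) powr \<beta>)"
      by (intro mult_left_mono) auto
    then show ?thesis
      using exp_le_quadratic[of "l * z"] True by (simp add: f_def power_mult_distrib mult.assoc)
  next
    case False
    then show ?thesis using c l0 by (simp add: f_def)
  qed
  have intf: "integrable M (\<lambda>\<omega>. f (Z i \<omega>))" if "i \<in> I" for i
  proof (rule integrable_const_bound)
    have "f z \<le> exp (l * c)" for z using l0 by (simp add: f_def)
    then show "AE \<omega> in M. norm (f (Z i \<omega>)) \<le> exp (l * c)" using f0 by simp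
  qed (use that in measurable)
  \<comment> \<open>The zero mean removes the term of first order in \<open>l\<close>; the
    exponential form of the bound turns the product over \<open>I\<close> into a sum in the
    exponent.\<close>
  have Ef: "expectation (\<lambda>\<omega>. f (Z i \<omega>)) \<le> exp (K * l\<^sup>2)" if i: "i \<in> I" for i
  proof -
    let ?g = "\<lambda>\<omega>. (Z i \<omega>)\<^sup>2 * exp (q * (max 0 (Z i \<omega>)) powr \<beta>)"
    have "expectation (\<lambda>\<omega>. f (Z i \<omega>)) \<le> expectation (\<lambda>\<omega>. 1 + l * Z i \<omega> + l\<^sup>2 * ?g \<omega>)"
      using i by (intro integral_mono intf Bochner_Integration.integrable_add integrable_mult_right int int2 f_bound) auto
    also have "\<dots> = 1 + l * expectation (Z i) + l\<^sup>2 * expectation ?g"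
      using int[OF i] int2[OF i] by (simp add: prob_space)
    also have "\<dots> \<le> 1 + l\<^sup>2 * K" using K[OF i] mean[OF i] by (simp add: mult_left_mono)
    also have "\<dots> \<le> exp (l\<^sup>2 * K)" by (rule exp_ge_add_one_self)
    finally show ?thesis by (simp add: mult.commute)
  qed
  have indepf: "indep_vars (\<lambda>_. borel) (\<lambda>i \<omega>. f (Z i \<omega>)) I"
    by (rule indep_vars_compose2[OF indep]) simp
  let ?P = "\<lambda>\<omega>. \<Prod>i\<in>I. f (Z i \<omega>)"
  have "prob {\<omega> \<in> space M. exp (l * c) \<le> ?P \<omega>} \<le> expectation ?P / exp (l * c)"
    by (rule integral_Markov_inequality_measure[where A = "{}"])
      (auto intro!: indep_vars_integrable I indepf intf prod_nonneg f0)
  also have "expectation ?P = (\<Prod>i\<in>I. expectation (\<lambda>\<omega>. f (Z i \<omega>)))"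
    by (intro indep_vars_lebesgue_integral I indepf intf)
  also have "\<dots> \<le> (\<Prod>i\<in>I. exp (K * l\<^sup>2))"
    using f0 by (intro prod_mono conjI Ef integral_nonneg) auto
  also have "\<dots> = exp (real (card I) * K * l\<^sup>2)"
    by (simp add: exp_of_nat_mult[symmetric] mult.assoc)
  finally have chernoff: "prob {\<omega> \<in> space M. exp (l * c) \<le> ?P \<omega>} \<le>
      exp (- q * c powr \<beta> + real (card I) * K * l\<^sup>2)"
    by (simp add: divide_right_mono lc exp_diff)
  have "{\<omega> \<in> space M. c < (\<Sum>i\<in>I. Z i \<omega>)} \<subseteq>
      (\<Union>i\<in>I. {\<omega> \<in> space M. c < Z i \<omega>}) \<union> {\<omega> \<in> space M. exp (l * c) \<le> ?P \<omega>}"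
  proof
    fix \<omega> assume \<omega>: "\<omega> \<in> {\<omega> \<in> space M. c < (\<Sum>i\<in>I. Z i \<omega>)}"
    have "exp (l * c) \<le> ?P \<omega>" if "\<not> (\<exists>i\<in>I. c < Z i \<omega>)"
    proof -
      have "exp (l * c) \<le> exp (l * (\<Sum>i\<in>I. Z i \<omega>))" using \<omega> l0 by simp
      also have "\<dots> = (\<Prod>i\<in>I. exp (l * Z i \<omega>))"
        using I by (simp add: exp_sum sum_distrib_left)
      also have "\<dots> = ?P \<omega>"
        using that by (intro prod.cong) (auto simp: f_def)
      finally show ?thesis .
    qed
    then show "\<omega> \<in> (\<Union>i\<in>I. {\<omega> \<in> space M. c < Z i \<omega>}) \<union> {\<omega> \<in> space M. exp (l * c) \<le> ?P \<omega>}"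
      using \<omega> by blast
  qed
  moreover have "(\<Union>i\<in>I. {\<omega> \<in> space M. c < Z i \<omega>}) \<in> sets M"
    using I by (intro sets.finite_UN) auto
  moreover have "{\<omega> \<in> space M. exp (l * c) \<le> ?P \<omega>} \<in> sets M"
    by measurable
  ultimately have "prob {\<omega> \<in> space M. c < (\<Sum>i\<in>I. Z i \<omega>)} \<le>
      prob (\<Union>i\<in>I. {\<omega> \<in> space M. c < Z i \<omega>}) + prob {\<omega> \<in> space M. exp (l * c) \<le> ?P \<omega>}"
    by (intro order_trans[OF finite_measure_mono measure_Un_le]) auto
  also have "prob (\<Union>i\<in>I. {\<omega> \<in> space M. c < Z i \<omega>}) \<le> (\<Sum>i\<in>I. prob {\<omega> \<in> space M. c < Z i \<omega>})"
    using I by (intro finite_measure_subadditive_finite) auto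
  finally show ?thesis using chernoff by (simp add: l_def)
qed

section \<open>Weighted moments of the Weibull distribution\<close>

text \<open>Put p = 2 / \<beta> and \<open>y = r powr \<beta>\<close>, so that
  \<open>y powr p\<close> is the square of \<open>r\<close>. The inequality ln u \<le> u at u = t y
  / p, multiplied by p and exponentiated, gives the constant.\<close>

lemma square_le_exp_powr:
  fixes r t \<beta> :: real
  assumes "0 < \<beta>" "0 < t" "0 \<le> r"
  shows "r\<^sup>2 \<le> (2 / (\<beta> * t)) powr (2 / \<beta>) * exp (t * r powr \<beta>)"
proof (cases "r = 0")
  case False
  then have r: "0 < r" using assms by simp
  define p where "p = 2 / \<beta>"
  have p: "0 < p" using assms by (simp add: p_def)
  define y where "y = r powr \<beta>"
  have y: "0 < y" using r by (simp add: y_def)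
  have "ln (t * y / p) \<le> t * y / p"
    using y p assms ln_le_minus_one[of "t * y / p"] by simp
  then have "p * ln (t * y / p) \<le> t * y" using p by (simp add: field_simps)
  then have "(t * y / p) powr p \<le> exp (t * y)"
    using y p assms by (simp add: powr_def)
  then have "(p / t) powr p * (t * y / p) powr p \<le> (p / t) powr p * exp (t * y)"
    by (intro mult_left_mono) auto
  also have "(p / t) powr p * (t * y / p) powr p = y powr p"
    using p assms y by (subst powr_mult[symmetric]) auto
  also have "y powr p = r\<^sup>2"
    using r assms by (simp add: y_def powr_powr p_def)
  finally show ?thesis using assms by (simp add: p_def y_def)
qed (use assms in simp)

text \<open>\<open>R powr \<beta>\<close> is exponentially distributed with rate
  \<open>\<kappa>\<close>, and the factor exp (s x) turns its density into a constant multiple of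
  the exponential density with rate \<open>\<kappa> - s\<close>.\<close>

lemma (in prob_space) weibull_exp_moment:
  assumes W: "weibull_distributed M \<kappa> \<beta> R" and \<beta>: "0 < \<beta>" and s: "s < \<kappa>" "0 < \<kappa>"
  shows "integrable M (\<lambda>\<omega>. exp (s * R \<omega> powr \<beta>))"
proof -
  have R[measurable]: "R \<in> borel_measurable M" and R0: "AE \<omega> in M. 0 \<le> R \<omega>"
    and tail: "\<And>x. 0 \<le> x \<Longrightarrow> \<P>(\<omega> in M. x < R \<omega>) = exp (- (\<kappa> * x powr \<beta>))"
    using W by (auto simp: weibull_distributed_def weibull_exponent_def)
  have "\<P>(\<omega> in M. R \<omega> powr \<beta> \<le> x) = 1 - exp (- x * \<kappa>)" if x: "0 \<le> x" for x
  proof -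
    have "\<P>(\<omega> in M. R \<omega> powr \<beta> \<le> x) = \<P>(\<omega> in M. \<not> x powr (1 / \<beta>) < R \<omega>)"
    proof (rule prob_eq_AE)
      show "AE \<omega> in M. (R \<omega> powr \<beta> \<le> x) = (\<not> x powr (1 / \<beta>) < R \<omega>)"
        using R0
      proof eventually_elim
        case (elim \<omega>)
        have "(R \<omega> powr \<beta>) powr (1 / \<beta>) = R \<omega>" using elim \<beta> by (simp add: powr_powr)
        moreover have "(x powr (1 / \<beta>)) powr \<beta> = x" using x \<beta> by (simp add: powr_powr)
        ultimately show ?case
          using powr_mono2[of "1 / \<beta>" "R \<omega> powr \<beta>" x] powr_mono2[of \<beta> "R \<omega>" "x powr (1 / \<beta>)"] \<beta> elim
          by force
      qed
    qed auto
    also have "\<dots> = 1 - \<P>(\<omega> in M. x powr (1 / \<beta>) < R \<omega>)"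
      by (rule prob_neg) measurable
    also have "\<dots> = 1 - exp (- x * \<kappa>)"
      using x \<beta> by (simp add: tail powr_powr mult.commute)
    finally show ?thesis .
  qed
  then have D: "distributed M lborel (\<lambda>\<omega>. R \<omega> powr \<beta>) (exponential_density \<kappa>)"
    using s by (subst exponential_distributed_iff) auto
  interpret E: prob_space "density lborel (exponential_density (\<kappa> - s))"
    using s by (intro prob_space_exponential_density) simp
  have nn: "exponential_density l x \<ge> 0" if "0 < l" for l x using that by (rule exponential_density_nonneg)
  have "integrable (density lborel (exponential_density (\<kappa> - s))) (\<lambda>_. \<kappa> / (\<kappa> - s) :: real)" by simp
  then have "integrable lborel (\<lambda>x. exponential_density (\<kappa> - s) x * (\<kappa> / (\<kappa> - s)))"
    using s nn by (subst (asm) integrable_real_density) auto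
  also have "(\<lambda>x. exponential_density (\<kappa> - s) x * (\<kappa> / (\<kappa> - s))) = (\<lambda>x. exponential_density \<kappa> x * exp (s * x))"
  proof
    fix x
    have "exp (- x * (\<kappa> - s)) = exp (- x * \<kappa>) * exp (s * x)"
      by (simp add: algebra_simps flip: exp_add)
    then show "exponential_density (\<kappa> - s) x * (\<kappa> / (\<kappa> - s)) = exponential_density \<kappa> x * exp (s * x)"
      using s by (simp add: exponential_density_def)
  qed
  finally show ?thesis
    using distributed_integrable[OF D, of "\<lambda>x. exp (s * x)"] s nn by auto
qed

text \<open>Half of the gap between \<open>s\<close> and \<open>\<kappa>\<close> pays for the
  quadratic factor; the other half keeps the exponential moment finite.\<close>

lemma (in prob_space) weibull_square_exp_moment:
  assumes W: "weibull_distributed M \<kappa> \<beta> R" and \<beta>: "0 < \<beta>" and s: "s < \<kappa>" "0 < \<kappa>"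
  shows "integrable M (\<lambda>\<omega>. (R \<omega>)\<^sup>2 * exp (s * R \<omega> powr \<beta>))"
proof -
  have R[measurable]: "R \<in> borel_measurable M" and R0: "AE \<omega> in M. 0 \<le> R \<omega>"
    using W by (auto simp: weibull_distributed_def)
  define t where "t = (\<kappa> - s) / 2"
  have t: "0 < t" "s + t < \<kappa>" using s by (auto simp: t_def field_simps)
  define C where "C = (2 / (\<beta> * t)) powr (2 / \<beta>)"
  have C0: "0 \<le> C" by (simp add: C_def)
  have "integrable M (\<lambda>\<omega>. C * exp ((s + t) * R \<omega> powr \<beta>))"
    using weibull_exp_moment[OF W \<beta> t(2) s(2)] by simp
  then show ?thesis
  proof (rule Bochner_Integration.integrable_bound)
    show "AE \<omega> in M. norm ((R \<omega>)\<^sup>2 * exp (s * R \<omega> powr \<beta>)) \<le> norm (C * exp ((s + t) * R \<omega> powr \<beta>))"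
      using R0
    proof eventually_elim
      case (elim \<omega>)
      have "(R \<omega>)\<^sup>2 * exp (s * R \<omega> powr \<beta>) \<le> (C * exp (t * R \<omega> powr \<beta>)) * exp (s * R \<omega> powr \<beta>)"
        using square_le_exp_powr[OF \<beta> t(1) elim] by (intro mult_right_mono) (auto simp: C_def)
      also have "\<dots> = C * exp ((s + t) * R \<omega> powr \<beta>)"
        by (simp add: algebra_simps exp_add)
      finally show ?case using C0 by simp
    qed
  qed measurable
qed

section \<open>Asymptotics of the probability bounds\<close>

text \<open>The numerator is the logarithm of the bound in \<open>deviation_prob_upper\<close>.
  After division the prefactor contributes order log n / n^\<beta> and the second-order term
  n^(\<beta> - 1), both of which vanish.\<close>

lemma upper_rate_limit:
  fixes N K \<beta> \<kappa> r :: real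
  assumes "0 < \<beta>" "\<beta> < 1" "0 < \<kappa>" "0 < N"
  shows "(\<lambda>n. (ln (N * (real n + 1)) + real n powr \<beta> * (K * real n powr (\<beta> - 1) - \<kappa> * r)) / (\<kappa> * real n powr \<beta>))
    \<longlonglongrightarrow> - r"
proof -
  have a: "(\<lambda>n. ln (N * (real n + 1)) / (\<kappa> * real n powr \<beta>)) \<longlonglongrightarrow> 0"
    using assms by real_asymp
  have b: "(\<lambda>n. real n powr (\<beta> - 1)) \<longlonglongrightarrow> 0"
    using assms by real_asymp
  have "(\<lambda>n. ln (N * (real n + 1)) / (\<kappa> * real n powr \<beta>) + (K / \<kappa> * real n powr (\<beta> - 1) - r)) \<longlonglongrightarrow>
      0 + (K / \<kappa> * 0 - r)"
    by (intro tendsto_intros a b)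
  then have lim: "(\<lambda>n. ln (N * (real n + 1)) / (\<kappa> * real n powr \<beta>) + (K / \<kappa> * real n powr (\<beta> - 1) - r))
      \<longlonglongrightarrow> - r"
    by simp
  show ?thesis
  proof (rule Lim_transform_eventually[OF lim])
    show "eventually (\<lambda>n. ln (N * (real n + 1)) / (\<kappa> * real n powr \<beta>) + (K / \<kappa> * real n powr (\<beta> - 1) - r) =
      (ln (N * (real n + 1)) + real n powr \<beta> * (K * real n powr (\<beta> - 1) - \<kappa> * r)) / (\<kappa> * real n powr \<beta>)) sequentially"
      using eventually_gt_at_top[of 0]
    proof eventually_elim
      case (elim n)
      have "real n powr \<beta> * (K * real n powr (\<beta> - 1) - \<kappa> * r) / (\<kappa> * real n powr \<beta>) =
          K / \<kappa> * real n powr (\<beta> - 1) - r"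
        using elim assms by (simp add: diff_divide_distrib)
      then show ?case by (simp add: add_divide_distrib)
    qed
  qed
qed

text \<open>The sequence is the bound from \<open>projected_sum_tail_linear\<close>; its vanishing
  shows that the later steps rarely cancel a large first one.\<close>

lemma tail_bound_limit:
  fixes K \<beta> b s :: real
  assumes "0 < \<beta>" "\<beta> < 1" "0 < b" "0 < s"
  shows "(\<lambda>n. real n * exp (- (b * real n powr \<beta>)) + exp (real n powr \<beta> * (K * real n powr (\<beta> - 1) - s))) \<longlonglongrightarrow> 0"
proof -
  have a: "(\<lambda>n. real n * exp (- (b * real n powr \<beta>))) \<longlonglongrightarrow> 0"
    using assms by real_asymp
  have b: "(\<lambda>n. real n powr (\<beta> - 1)) \<longlonglongrightarrow> 0" and c: "filterlim (\<lambda>n. real n powr \<beta>) at_top sequentially"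
    using assms by real_asymp+
  have "(\<lambda>n. K * real n powr (\<beta> - 1) - s) \<longlonglongrightarrow> K * 0 - s"
    by (intro tendsto_intros b)
  then have "filterlim (\<lambda>n. (K * real n powr (\<beta> - 1) - s) * real n powr \<beta>) at_bot sequentially"
    using assms by (intro filterlim_tendsto_neg_mult_at_bot[OF _ _ c, of _ "- s"]) auto
  then have "(\<lambda>n. exp (real n powr \<beta> * (K * real n powr (\<beta> - 1) - s))) \<longlonglongrightarrow> 0"
    using filterlim_compose[OF exp_at_bot] by (simp add: mult.commute)
  from tendsto_add[OF a this] show ?thesis by simp
qed

lemma lower_rate_limit:
  fixes L \<beta> \<kappa> r :: real
  assumes "0 < \<beta>" "0 < \<kappa>"
  shows "(\<lambda>n. L / (\<kappa> * real n powr \<beta>) - r) \<longlonglongrightarrow> - r"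
proof -
  have "(\<lambda>n. inverse (\<kappa> * real n powr \<beta>)) \<longlonglongrightarrow> 0"
    using assms by real_asymp
  from tendsto_diff[OF tendsto_mult[OF tendsto_const[of L] this] tendsto_const[of r]]
  show ?thesis by (simp add: divide_inverse)
qed

section \<open>The walk and the law of its increments\<close>

locale heavy_tailed_walk = prob_space M
  for M :: "'a measure" +
  fixes R :: "'a \<Rightarrow> real"
    and \<Theta> :: "'a \<Rightarrow> real ^ 'n::finite"
    and X :: "nat \<Rightarrow> 'a \<Rightarrow> real ^ 'n"
    and A :: "real ^ 'n ^ 'n"
    and \<kappa> \<beta> :: real
  assumes \<beta>: "0 < \<beta>" "\<beta> < 1" and \<kappa>: "0 < \<kappa>"
    and weibull: "weibull_distributed M \<kappa> \<beta> R"
    and diag_A: "diagonal_mat A" and A_pos: "\<forall>k. 0 < A $ k $ k"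
    and angular: "angular_assumption M R \<Theta> ((\<lambda>x. A *v x) ` sphere 0 1)"
    and indep_X: "indep_vars (\<lambda>_. borel) X {1..}"
    and distr_X: "\<forall>i\<ge>1. distr M borel (X i) = distr M borel (\<lambda>\<omega>. R \<omega> *\<^sub>R \<Theta> \<omega>)"
begin

abbreviation \<Omega> :: "(real ^ 'n) set" where "\<Omega> \<equiv> (\<lambda>x. A *v x) ` sphere 0 1"

lemma R_measurable[measurable]: "R \<in> borel_measurable M"
  and R_nonneg: "AE \<omega> in M. 0 \<le> R \<omega>"
  and R_tail: "0 \<le> x \<Longrightarrow> \<P>(\<omega> in M. x < R \<omega>) = exp (- (\<kappa> * x powr \<beta>))"
  using weibull by (auto simp: weibull_distributed_def weibull_exponent_def)

lemma Theta_measurable[measurable]: "\<Theta> \<in> borel_measurable M"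
  and Theta_in: "AE \<omega> in M. \<Theta> \<omega> \<in> \<Omega>"
  and increment_mean: "has_bochner_integral M (\<lambda>\<omega>. R \<omega> *\<^sub>R \<Theta> \<omega>) 0"
  using angular by (auto simp: angular_assumption_def)

lemma X_measurable[measurable]: "1 \<le> i \<Longrightarrow> X i \<in> borel_measurable M"
  using indep_X by (auto simp: indep_vars_def)

lemma X_prob_eq:
  assumes "1 \<le> i" and [measurable]: "Measurable.pred borel P"
  shows "\<P>(\<omega> in M. P (X i \<omega>)) = \<P>(\<omega> in M. P (R \<omega> *\<^sub>R \<Theta> \<omega>))"
proof -
  have B: "{x. P x} \<in> sets borel" by measurable
  have "\<P>(\<omega> in M. P (X i \<omega>)) = measure (distr M borel (X i)) {x. P x}"
    using assms(1) B by (subst measure_distr) (auto intro!: arg_cong[where f = prob])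
  also have "\<dots> = measure (distr M borel (\<lambda>\<omega>. R \<omega> *\<^sub>R \<Theta> \<omega>)) {x. P x}"
    using distr_X assms(1) by simp
  also have "\<dots> = \<P>(\<omega> in M. P (R \<omega> *\<^sub>R \<Theta> \<omega>))"
    using B by (subst measure_distr) (auto intro!: arg_cong[where f = prob])
  finally show ?thesis .
qed

lemma
  fixes g :: "real ^ 'n \<Rightarrow> real"
  assumes "1 \<le> i" and [measurable]: "g \<in> borel_measurable borel"
  shows X_integrable_iff: "integrable M (\<lambda>\<omega>. g (X i \<omega>)) \<longleftrightarrow> integrable M (\<lambda>\<omega>. g (R \<omega> *\<^sub>R \<Theta> \<omega>))"
    and X_expectation_eq: "expectation (\<lambda>\<omega>. g (X i \<omega>)) = expectation (\<lambda>\<omega>. g (R \<omega> *\<^sub>R \<Theta> \<omega>))"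
proof -
  note [measurable] = X_measurable[OF assms(1)]
  have d: "distr M borel (X i) = distr M borel (\<lambda>\<omega>. R \<omega> *\<^sub>R \<Theta> \<omega>)"
    using distr_X assms(1) by simp
  show "integrable M (\<lambda>\<omega>. g (X i \<omega>)) \<longleftrightarrow> integrable M (\<lambda>\<omega>. g (R \<omega> *\<^sub>R \<Theta> \<omega>))"
    using integrable_distr_eq[of "X i" M borel g] integrable_distr_eq[of "\<lambda>\<omega>. R \<omega> *\<^sub>R \<Theta> \<omega>" M borel g] d
    by simp
  show "expectation (\<lambda>\<omega>. g (X i \<omega>)) = expectation (\<lambda>\<omega>. g (R \<omega> *\<^sub>R \<Theta> \<omega>))"
    using integral_distr[of "X i" M borel g] integral_distr[of "\<lambda>\<omega>. R \<omega> *\<^sub>R \<Theta> \<omega>" M borel g] d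
    by simp
qed

section \<open>Tail bounds for one-dimensional projections\<close>

lemma projected_sum_tail:
  fixes w :: "real ^ 'n"
  assumes m: "0 < m" and w: "\<And>\<theta>. \<theta> \<in> \<Omega> \<Longrightarrow> \<bar>w \<bullet> \<theta>\<bar> \<le> m" and s: "0 < s" "s < \<kappa>"
  shows "\<exists>K. \<forall>n I c. I \<subseteq> {1..n} \<longrightarrow> 0 < c \<longrightarrow>
    \<P>(\<omega> in M. c < (\<Sum>i\<in>I. w \<bullet> X i \<omega>)) \<le>
      real n * exp (- (\<kappa> * (c / m) powr \<beta>)) + exp (real n * K * (c powr (\<beta> - 1))\<^sup>2 - s * (c / m) powr \<beta>)"
proof -
  \<comment> \<open>With this scaling \<open>q * (m * r) powr \<beta>\<close> equals
    \<open>s * r powr \<beta>\<close>, so the weight of a projection is dominated by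
    \<open>exp (s * R powr \<beta>)\<close>, which is integrable with the factor of second order
    since \<open>s < \<kappa>\<close>.\<close>
  define q where "q = s / m powr \<beta>"
  have q0: "0 < q" using s m by (simp add: q_def)
  have qm: "q * (m * r) powr \<beta> = s * r powr \<beta>" if "0 \<le> r" for r
    using m that by (simp add: q_def powr_mult)
  have qc: "q * c powr \<beta> = s * (c / m) powr \<beta>" if "0 < c" for c
    using m that by (simp add: q_def powr_divide)
  define g where "g x = (w \<bullet> x)\<^sup>2 * exp (q * (max 0 (w \<bullet> x)) powr \<beta>)" for x
  have g[measurable]: "g \<in> borel_measurable borel" unfolding g_def by measurable
  have bnd: "AE \<omega> in M. \<bar>w \<bullet> (R \<omega> *\<^sub>R \<Theta> \<omega>)\<bar> \<le> m * R \<omega>"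
    using R_nonneg Theta_in
  proof eventually_elim
    case (elim \<omega>)
    then have "R \<omega> * \<bar>w \<bullet> \<Theta> \<omega>\<bar> \<le> R \<omega> * m" by (intro mult_left_mono w)
    then show ?case using elim by (simp add: abs_mult mult.commute)
  qed
  have "integrable M (\<lambda>\<omega>. m\<^sup>2 * ((R \<omega>)\<^sup>2 * exp (s * R \<omega> powr \<beta>)))"
    using weibull_square_exp_moment[OF weibull \<beta>(1) s(2) \<kappa>] by simp
  then have intg: "integrable M (\<lambda>\<omega>. g (R \<omega> *\<^sub>R \<Theta> \<omega>))"
  proof (rule Bochner_Integration.integrable_bound)
    show "AE \<omega> in M. norm (g (R \<omega> *\<^sub>R \<Theta> \<omega>)) \<le> norm (m\<^sup>2 * ((R \<omega>)\<^sup>2 * exp (s * R \<omega> powr \<beta>)))"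
      using bnd R_nonneg
    proof eventually_elim
      case (elim \<omega>)
      let ?z = "w \<bullet> (R \<omega> *\<^sub>R \<Theta> \<omega>)"
      have "?z\<^sup>2 \<le> (m * R \<omega>)\<^sup>2" using elim by (metis abs_le_square_iff abs_of_nonneg order_trans abs_ge_zero)
      moreover have "(max 0 ?z) powr \<beta> \<le> (m * R \<omega>) powr \<beta>"
        using elim m \<beta> by (intro powr_mono2) auto
      then have "q * (max 0 ?z) powr \<beta> \<le> s * R \<omega> powr \<beta>"
        using q0 elim by (subst qm[symmetric]) (auto intro: mult_left_mono)
      ultimately have "?z\<^sup>2 * exp (q * (max 0 ?z) powr \<beta>) \<le> (m * R \<omega>)\<^sup>2 * exp (s * R \<omega> powr \<beta>)"
        by (intro mult_mono) auto
      then show ?case by (simp add: g_def power_mult_distrib mult.assoc del: inner_scaleR_right)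
    qed
  qed measurable
  define K0 where "K0 = expectation (\<lambda>\<omega>. g (R \<omega> *\<^sub>R \<Theta> \<omega>))"
  have K0: "0 \<le> K0" unfolding K0_def by (simp add: g_def)
  have lin: "integrable M (\<lambda>\<omega>. w \<bullet> (R \<omega> *\<^sub>R \<Theta> \<omega>))" "expectation (\<lambda>\<omega>. w \<bullet> (R \<omega> *\<^sub>R \<Theta> \<omega>)) = 0"
  proof -
    have "has_bochner_integral M (\<lambda>\<omega>. w \<bullet> (R \<omega> *\<^sub>R \<Theta> \<omega>)) (w \<bullet> 0)"
      using increment_mean by (rule has_bochner_integral_inner_right)
    then show "integrable M (\<lambda>\<omega>. w \<bullet> (R \<omega> *\<^sub>R \<Theta> \<omega>))" "expectation (\<lambda>\<omega>. w \<bullet> (R \<omega> *\<^sub>R \<Theta> \<omega>)) = 0"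
      by (auto simp: has_bochner_integral_iff simp del: inner_scaleR_right)
  qed
  have tail: "\<P>(\<omega> in M. c < w \<bullet> X i \<omega>) \<le> exp (- (\<kappa> * (c / m) powr \<beta>))" if "1 \<le> i" "0 < c" for i c
  proof -
    have "\<P>(\<omega> in M. c < w \<bullet> X i \<omega>) = \<P>(\<omega> in M. c < w \<bullet> (R \<omega> *\<^sub>R \<Theta> \<omega>))"
      using that by (intro X_prob_eq) auto
    also have "\<dots> \<le> \<P>(\<omega> in M. c / m < R \<omega>)"
    proof (rule finite_measure_mono_AE)
      show "AE \<omega> in M. \<omega> \<in> {\<omega> \<in> space M. c < w \<bullet> (R \<omega> *\<^sub>R \<Theta> \<omega>)} \<longrightarrow> \<omega> \<in> {\<omega> \<in> space M. c / m < R \<omega>}"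
        using bnd by eventually_elim (use m in \<open>auto simp: field_simps\<close>)
    qed measurable
    also have "\<dots> = exp (- (\<kappa> * (c / m) powr \<beta>))"
      using that m by (intro R_tail) auto
    finally show ?thesis .
  qed
  show ?thesis
  proof (intro exI allI impI)
    fix n :: nat and I :: "nat set" and c :: real
    assume I: "I \<subseteq> {1..n}" and c: "0 < c"
    have fin: "finite I" using I finite_subset by blast
    have I1: "1 \<le> i" if "i \<in> I" for i using I that by auto
    have card: "card I \<le> n" using card_mono[OF _ I] by simp
    have "indep_vars (\<lambda>_. borel) X I"
      using indep_X by (rule indep_vars_subset) (use I in auto)
    then have ind: "indep_vars (\<lambda>_. borel) (\<lambda>i \<omega>. w \<bullet> X i \<omega>) I"
      by (rule indep_vars_compose2) measurable
    have "\<P>(\<omega> in M. c < (\<Sum>i\<in>I. w \<bullet> X i \<omega>)) \<le>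
      (\<Sum>i\<in>I. \<P>(\<omega> in M. c < w \<bullet> X i \<omega>)) +
      exp (- q * c powr \<beta> + real (card I) * K0 * (q * c powr (\<beta> - 1))\<^sup>2)"
    proof (rule truncated_chernoff_sum[OF fin ind _ _ _ _ \<beta> q0 c])
      fix i assume "i \<in> I"
      then have i: "1 \<le> i" by (rule I1)
      show "integrable M (\<lambda>\<omega>. w \<bullet> X i \<omega>)" "expectation (\<lambda>\<omega>. w \<bullet> X i \<omega>) = 0"
        using X_integrable_iff[OF i, of "\<lambda>x. w \<bullet> x"] X_expectation_eq[OF i, of "\<lambda>x. w \<bullet> x"] lin by (auto simp del: inner_scaleR_right)
      show "integrable M (\<lambda>\<omega>. (w \<bullet> X i \<omega>)\<^sup>2 * exp (q * (max 0 (w \<bullet> X i \<omega>)) powr \<beta>))"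
        "expectation (\<lambda>\<omega>. (w \<bullet> X i \<omega>)\<^sup>2 * exp (q * (max 0 (w \<bullet> X i \<omega>)) powr \<beta>)) \<le> K0"
        using X_integrable_iff[OF i g] X_expectation_eq[OF i g] intg by (auto simp: K0_def g_def simp del: inner_scaleR_right)
    qed
    also have "\<dots> \<le> (\<Sum>i\<in>I. exp (- (\<kappa> * (c / m) powr \<beta>))) +
      exp (real n * K0 * (q * c powr (\<beta> - 1))\<^sup>2 - s * (c / m) powr \<beta>)"
      using card K0 c qc[OF c] by (intro add_mono sum_mono tail I1) (auto intro!: mult_right_mono)
    \<comment> \<open>The factor from \<open>q\<close> is absorbed here, so the witness for
      \<open>K\<close> is \<open>K0 * q\<^sup>2\<close>.\<close>
    also have "\<dots> \<le> real n * exp (- (\<kappa> * (c / m) powr \<beta>)) +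
      exp (real n * (K0 * q\<^sup>2) * (c powr (\<beta> - 1))\<^sup>2 - s * (c / m) powr \<beta>)"
      using card by (auto simp: power_mult_distrib mult.assoc intro!: mult_right_mono)
    finally show "\<P>(\<omega> in M. c < (\<Sum>i\<in>I. w \<bullet> X i \<omega>)) \<le> real n * exp (- (\<kappa> * (c / m) powr \<beta>)) +
      exp (real n * (K0 * q\<^sup>2) * (c powr (\<beta> - 1))\<^sup>2 - s * (c / m) powr \<beta>)" .
  qed
qed

text \<open>At the linear scale \<open>c = t n\<close> the error term \<open>n c\<^sup>2\<^sup>\<beta>\<^sup>-\<^sup>2\<close> is of lower order than \<open>n\<^sup>\<beta>\<close>.\<close>

lemma projected_sum_tail_linear:
  fixes w :: "real ^ 'n"
  assumes m: "0 < m" and w: "\<And>\<theta>. \<theta> \<in> \<Omega> \<Longrightarrow> \<bar>w \<bullet> \<theta>\<bar> \<le> m" and s: "0 < s" "s < \<kappa>" and t: "0 < t"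
  shows "\<exists>K. \<forall>n\<ge>1. \<forall>I\<subseteq>{1..n}. \<P>(\<omega> in M. t * real n < (\<Sum>i\<in>I. w \<bullet> X i \<omega>)) \<le>
      real n * exp (- (\<kappa> * (t / m) powr \<beta> * real n powr \<beta>)) +
      exp (real n powr \<beta> * (K * real n powr (\<beta> - 1) - s * (t / m) powr \<beta>))"
proof -
  obtain K where K: "\<And>n I c. I \<subseteq> {1..n} \<Longrightarrow> 0 < c \<Longrightarrow>
    \<P>(\<omega> in M. c < (\<Sum>i\<in>I. w \<bullet> X i \<omega>)) \<le>
      real n * exp (- (\<kappa> * (c / m) powr \<beta>)) + exp (real n * K * (c powr (\<beta> - 1))\<^sup>2 - s * (c / m) powr \<beta>)"
    using projected_sum_tail[OF m w s] by blast
  show ?thesis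
  proof (intro exI allI impI)
    fix n :: nat and I assume n: "1 \<le> n" and I: "I \<subseteq> {1..n}"
    have sc: "(t * real n / m) powr \<beta> = (t / m) powr \<beta> * real n powr \<beta>"
      using t m by (subst powr_mult[symmetric]) auto
    have "real n * ((t * real n) powr (\<beta> - 1))\<^sup>2 = (t powr (\<beta> - 1))\<^sup>2 * (real n * real n powr (\<beta> - 1)) * real n powr (\<beta> - 1)"
      using t by (simp add: powr_mult power2_eq_square)
    also have "real n * real n powr (\<beta> - 1) = real n powr \<beta>"
      using n by (simp add: powr_diff)
    finally have "real n * K * ((t * real n) powr (\<beta> - 1))\<^sup>2 = real n powr \<beta> * (K * (t powr (\<beta> - 1))\<^sup>2 * real n powr (\<beta> - 1))"
      by (simp add: mult_ac)
    then have "real n * K * ((t * real n) powr (\<beta> - 1))\<^sup>2 - s * (t * real n / m) powr \<beta> =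
      real n powr \<beta> * (K * (t powr (\<beta> - 1))\<^sup>2 * real n powr (\<beta> - 1) - s * (t / m) powr \<beta>)"
      unfolding sc by (simp add: algebra_simps)
    then show "\<P>(\<omega> in M. t * real n < (\<Sum>i\<in>I. w \<bullet> X i \<omega>)) \<le>
      real n * exp (- (\<kappa> * (t / m) powr \<beta> * real n powr \<beta>)) +
      exp (real n powr \<beta> * (K * (t powr (\<beta> - 1))\<^sup>2 * real n powr (\<beta> - 1) - s * (t / m) powr \<beta>))"
      using K[OF I, of "t * real n"] n t sc by (simp add: mult.assoc)
  qed
qed

section \<open>Upper and lower bounds for deviation probabilities\<close>

lemma random_walk_inner: "w \<bullet> random_walk X n \<omega> = (\<Sum>i\<in>{1..n}. w \<bullet> X i \<omega>)"
  by (simp add: random_walk_def inner_sum_right)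

lemma random_walk_measurable[measurable]: "random_walk X n \<in> borel_measurable M"
  unfolding random_walk_def by measurable

lemma retained_walk_measurable[measurable]: "retained_walk X D n \<in> borel_measurable M"
  unfolding retained_walk_def
  by (intro borel_measurable_continuous_on[OF _ random_walk_measurable] continuous_intros)

definition deviation_prob :: "real ^ 'n ^ 'n \<Rightarrow> real \<Rightarrow> nat \<Rightarrow> real" where
  "deviation_prob D a n = \<P>(\<omega> in M. norm (retained_walk X D n \<omega> /\<^sub>R real n) > a)"

lemma deviation_prob_eq:
  assumes "1 \<le> n"
  shows "deviation_prob D a n = \<P>(\<omega> in M. a * real n < norm (D *v random_walk X n \<omega>))"
  using assms by (simp add: deviation_prob_def retained_walk_def divide_inverse[symmetric] field_simps)

text \<open>A vector of norm above \<open>a * n\<close> has inner product above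
  \<open>(1 - \<delta>) * a * n\<close> with some direction of the finite net, so a union bound over
  the net suffices. Moving \<open>D\<close> to the other side of the inner product makes each event
  a tail event of a projected walk.\<close>

lemma deviation_prob_upper:
  fixes D :: "real ^ 'n ^ 'n"
  assumes m: "0 < m" and D: "\<And>\<theta>. \<theta> \<in> \<Omega> \<Longrightarrow> norm (D *v \<theta>) \<le> m"
    and s: "0 < s" "s < \<kappa>" and \<delta>: "0 < \<delta>" "\<delta> < 1" and a: "0 < a"
  shows "\<exists>N K. 0 < N \<and> (\<forall>n\<ge>1. deviation_prob D a n \<le>
    N * (real n + 1) * exp (real n powr \<beta> * (K * real n powr (\<beta> - 1) - s * ((1 - \<delta>) * a / m) powr \<beta>)))"
proof -
  define t where "t = (1 - \<delta>) * a"
  have t: "0 < t" using \<delta> a by (simp add: t_def)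
  obtain V where V: "finite V" "V \<subseteq> sphere (0 :: real ^ 'n) 1"
    and net: "\<And>v. v \<noteq> 0 \<Longrightarrow> \<exists>u\<in>V. (1 - \<delta>) * norm v \<le> u \<bullet> v"
    using finite_direction_net[OF \<delta>(1)] by blast
  define F where "F K n = real n * exp (- (\<kappa> * (t / m) powr \<beta> * real n powr \<beta>)) +
      exp (real n powr \<beta> * (K * real n powr (\<beta> - 1) - s * (t / m) powr \<beta>))" for K and n :: nat
  have "\<exists>K. \<forall>n\<ge>1. \<P>(\<omega> in M. t * real n < u \<bullet> (D *v random_walk X n \<omega>)) \<le> F K n" if "u \<in> V" for u
  proof -
    have "\<bar>(u v* D) \<bullet> \<theta>\<bar> \<le> m" if "\<theta> \<in> \<Omega>" for \<theta>
    proof -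
      have "\<bar>(u v* D) \<bullet> \<theta>\<bar> \<le> norm u * norm (D *v \<theta>)"
        by (simp add: dot_lmul_matrix Cauchy_Schwarz_ineq2)
      also have "\<dots> \<le> m" using V(2) \<open>u \<in> V\<close> D[OF that] by auto
      finally show ?thesis .
    qed
    from projected_sum_tail_linear[OF m this s t] obtain K where
      "\<forall>n\<ge>1. \<forall>I\<subseteq>{1..n}. \<P>(\<omega> in M. t * real n < (\<Sum>i\<in>I. (u v* D) \<bullet> X i \<omega>)) \<le> F K n"
      unfolding F_def by blast
    then have "\<forall>n\<ge>1. \<P>(\<omega> in M. t * real n < u \<bullet> (D *v random_walk X n \<omega>)) \<le> F K n"
      by (simp add: random_walk_inner flip: dot_lmul_matrix)
    then show ?thesis ..
  qed
  then have "\<forall>u\<in>V. \<exists>K. \<forall>n\<ge>1. \<P>(\<omega> in M. t * real n < u \<bullet> (D *v random_walk X n \<omega>)) \<le> F K n"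
    by blast
  from bchoice[OF this] obtain K where K: "\<And>u n. u \<in> V \<Longrightarrow> 1 \<le> n \<Longrightarrow>
      \<P>(\<omega> in M. t * real n < u \<bullet> (D *v random_walk X n \<omega>)) \<le> F (K u) n"
    by blast
  \<comment> \<open>One constant for all directions. Inserting 0 makes it nonnegative, which the
    comparison with the one-step term uses.\<close>
  define L where "L = Max (insert 0 (K ` V))"
  have L0: "0 \<le> L" and L: "u \<in> V \<Longrightarrow> K u \<le> L" for u
    using V(1) by (auto simp: L_def)
  define G where "G n = exp (real n powr \<beta> * (L * real n powr (\<beta> - 1) - s * (t / m) powr \<beta>))" for n :: nat
  have FG: "F (K u) n \<le> (real n + 1) * G n" if "u \<in> V" for u and n :: nat
  proof -
    have "real n powr \<beta> * (K u * real n powr (\<beta> - 1) - s * (t / m) powr \<beta>) \<le>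
        real n powr \<beta> * (L * real n powr (\<beta> - 1) - s * (t / m) powr \<beta>)"
      using L[OF that] by (intro mult_left_mono diff_right_mono mult_right_mono) auto
    \<comment> \<open>As \<open>s < \<kappa>\<close>, the one-step term is also dominated by
      \<open>G n\<close>; its factor \<open>n\<close> leads to the prefactor
      \<open>n + 1\<close>.\<close>
    moreover have "real n powr \<beta> * (- (\<kappa> * (t / m) powr \<beta>)) \<le>
        real n powr \<beta> * (L * real n powr (\<beta> - 1) - s * (t / m) powr \<beta>)"
    proof (rule mult_left_mono)
      have "s * (t / m) powr \<beta> \<le> \<kappa> * (t / m) powr \<beta>" using s by (intro mult_right_mono) auto
      moreover have "0 \<le> L * real n powr (\<beta> - 1)" using L0 by simp
      ultimately show "- (\<kappa> * (t / m) powr \<beta>) \<le> L * real n powr (\<beta> - 1) - s * (t / m) powr \<beta>" by linarith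
    qed simp
    ultimately have "F (K u) n \<le> real n * G n + G n"
      unfolding F_def G_def by (intro add_mono mult_left_mono) (auto simp: mult_ac)
    then show ?thesis by (simp add: algebra_simps)
  qed
  have "deviation_prob D a n \<le> (real (card V) + 1) * (real n + 1) * G n" if n: "1 \<le> n" for n
  proof -
    have "deviation_prob D a n \<le> prob (\<Union>u\<in>V. {\<omega> \<in> space M. t * real n < u \<bullet> (D *v random_walk X n \<omega>)})"
      unfolding deviation_prob_eq[OF n]
    proof (rule finite_measure_mono)
      show "{\<omega> \<in> space M. a * real n < norm (D *v random_walk X n \<omega>)} \<subseteq>
        (\<Union>u\<in>V. {\<omega> \<in> space M. t * real n < u \<bullet> (D *v random_walk X n \<omega>)})"
      proof
        fix \<omega> assume \<omega>: "\<omega> \<in> {\<omega> \<in> space M. a * real n < norm (D *v random_walk X n \<omega>)}"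
        let ?v = "D *v random_walk X n \<omega>"
        have an: "a * real n < norm ?v" using \<omega> by simp
        moreover have "0 \<le> a * real n" using a by simp
        ultimately have "?v \<noteq> 0" by (metis norm_zero not_less)
        then obtain u where u: "u \<in> V" "(1 - \<delta>) * norm ?v \<le> u \<bullet> ?v" using net by blast
        have "t * real n < (1 - \<delta>) * norm ?v" using an \<delta> by (simp add: t_def mult.assoc)
        with u show "\<omega> \<in> (\<Union>u\<in>V. {\<omega> \<in> space M. t * real n < u \<bullet> (D *v random_walk X n \<omega>)})"
          using \<omega> by force
      qed
      have "{\<omega> \<in> space M. t * real n < u \<bullet> (D *v random_walk X n \<omega>)} \<in> sets M" for u
        unfolding retained_walk_def[symmetric] by measurable
      then show "(\<Union>u\<in>V. {\<omega> \<in> space M. t * real n < u \<bullet> (D *v random_walk X n \<omega>)}) \<in> sets M"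
        using V(1) by (intro sets.finite_UN) auto
    qed
    also have "\<dots> \<le> (\<Sum>u\<in>V. \<P>(\<omega> in M. t * real n < u \<bullet> (D *v random_walk X n \<omega>)))"
    proof (rule finite_measure_subadditive_finite[OF V(1)])
      show "(\<lambda>u. {\<omega> \<in> space M. t * real n < u \<bullet> (D *v random_walk X n \<omega>)}) ` V \<subseteq> sets M"
        unfolding retained_walk_def[symmetric] by auto
    qed
    also have "\<dots> \<le> (\<Sum>u\<in>V. (real n + 1) * G n)"
      using K n FG by (intro sum_mono) (meson order_trans)
    also have "\<dots> \<le> (real (card V) + 1) * (real n + 1) * G n"
      by (simp add: algebra_simps G_def)
    finally show ?thesis .
  qed
  moreover have "0 < real (card V) + 1" by simp
  ultimately show ?thesis unfolding G_def t_def by blast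
qed

text \<open>A single large first step in the direction of the longest axis, all other steps adding
  up to little, already produces the deviation.\<close>

lemma deviation_prob_lower:
  fixes D :: "real ^ 'n ^ 'n"
  assumes D: "diagonal_mat D" "0 < D $ k $ k" "D $ k $ k * A $ k $ k = m"
    and m: "0 < m" and Dm: "\<And>\<theta>. \<theta> \<in> \<Omega> \<Longrightarrow> norm (D *v \<theta>) \<le> m"
    and \<delta>: "0 < \<delta>" "\<delta> < 1" and a: "0 < a"
  shows "\<exists>p>0. \<forall>\<^sub>F n in sequentially.
    p * exp (- (\<kappa> * ((a + \<delta>) / ((1 - \<delta>) * m)) powr \<beta> * real n powr \<beta>)) \<le> deviation_prob D a n"
proof -
  define S where "S = {\<theta> \<in> \<Omega>. (1 - \<delta>) * A $ k $ k < \<theta> $ k}"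
  define w :: "real ^ 'n" where "w = axis k (D $ k $ k)"
  have w: "w \<bullet> v = (D *v v) $ k" for v
    using D(1) by (simp add: w_def inner_axis' diagonal_mat_mult_component)
  have wm: "\<bar>(- w) \<bullet> \<theta>\<bar> \<le> m" if "\<theta> \<in> \<Omega>" for \<theta>
    using Dm[OF that] component_le_norm_cart[of "D *v \<theta>" k] by (simp add: w)
  have "compact \<Omega>"
    by (intro compact_continuous_image continuous_intros compact_sphere)
  then have "\<Omega> \<in> sets borel" by (simp add: borel_closed compact_imp_closed)
  moreover have "S = \<Omega> \<inter> {\<theta>. (1 - \<delta>) * A $ k $ k < \<theta> $ k}" by (auto simp: S_def)
  moreover have "{\<theta> :: real ^ 'n. (1 - \<delta>) * A $ k $ k < \<theta> $ k} \<in> sets borel"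
    by (intro borel_open open_Collect_less continuous_intros)
  ultimately have S[measurable]: "S \<in> sets borel" by simp
  have "surface_measure S > 0"
    unfolding S_def by (rule ellipsoid_cap_surface_measure_pos[OF diag_A A_pos \<delta>])
  then have pS: "\<P>(\<omega> in M. \<Theta> \<omega> \<in> S) > 0"
    and lim: "((\<lambda>x. \<P>(\<omega> in M. \<Theta> \<omega> \<in> S \<bar> R \<omega> > x)) \<longlongrightarrow> \<P>(\<omega> in M. \<Theta> \<omega> \<in> S)) at_top"
    using angular S by (auto simp: angular_assumption_def S_def)
  define p where "p = \<P>(\<omega> in M. \<Theta> \<omega> \<in> S)"
  have p0: "0 < p" using pS by (simp add: p_def)
  \<comment> \<open>On the cap \<open>w \<bullet> \<theta>\<close> exceeds
    \<open>(1 - \<delta>) * m\<close>, so a radius above \<open>y n\<close> yields a step above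
    \<open>(a + \<delta>) * n\<close>. The surplus \<open>\<delta> * n\<close> is what the other
    steps may take away.\<close>
  define y where "y n = (a + \<delta>) / ((1 - \<delta>) * m) * real n" for n :: nat
  have y0: "0 \<le> y n" for n using a \<delta> m by (simp add: y_def)
  have c0: "0 < (a + \<delta>) / ((1 - \<delta>) * m)" using a \<delta> m by simp
  have "filterlim y at_top sequentially"
    unfolding y_def by (rule filterlim_tendsto_pos_mult_at_top[OF tendsto_const c0 filterlim_real_sequentially])
  from filterlim_compose[OF lim this]
  have "\<forall>\<^sub>F n in sequentially. p / 2 < \<P>(\<omega> in M. \<Theta> \<omega> \<in> S \<bar> R \<omega> > y n)"
    using p0 by (intro order_tendstoD) (auto simp: p_def)
  moreover
  \<comment> \<open>The bound is applied to \<open>- w\<close>, since only a strongly negative sum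
    of the other steps does harm. Any parameter between 0 and \<open>\<kappa>\<close> would serve in
    place of \<open>\<kappa> / 2\<close>, because only convergence to 0 matters.\<close>
  obtain K where K: "\<And>n I. 1 \<le> n \<Longrightarrow> I \<subseteq> {1..n} \<Longrightarrow> \<P>(\<omega> in M. \<delta> * real n < (\<Sum>i\<in>I. (- w) \<bullet> X i \<omega>)) \<le>
      real n * exp (- (\<kappa> * (\<delta> / m) powr \<beta> * real n powr \<beta>)) +
      exp (real n powr \<beta> * (K * real n powr (\<beta> - 1) - \<kappa> / 2 * (\<delta> / m) powr \<beta>))"
    using projected_sum_tail_linear[OF m wm _ _ \<delta>(1), of "\<kappa> / 2"] \<kappa> by auto
  have "(\<lambda>n. real n * exp (- (\<kappa> * (\<delta> / m) powr \<beta> * real n powr \<beta>)) +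
      exp (real n powr \<beta> * (K * real n powr (\<beta> - 1) - \<kappa> / 2 * (\<delta> / m) powr \<beta>))) \<longlonglongrightarrow> 0"
    using \<kappa> \<delta> m by (intro tail_bound_limit \<beta>) auto
  then have "\<forall>\<^sub>F n in sequentially. real n * exp (- (\<kappa> * (\<delta> / m) powr \<beta> * real n powr \<beta>)) +
      exp (real n powr \<beta> * (K * real n powr (\<beta> - 1) - \<kappa> / 2 * (\<delta> / m) powr \<beta>)) < 1 / 2"
    by (rule order_tendstoD) simp
  moreover note eventually_ge_at_top[of "1 :: nat"]
  ultimately have "\<forall>\<^sub>F n in sequentially. p / 4 * exp (- (\<kappa> * y n powr \<beta>)) \<le> deviation_prob D a n"
  proof eventually_elim
    case (elim n)
    note n = \<open>1 \<le> n\<close>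
    note [measurable] = X_measurable[of 1, simplified]
    let ?T = "\<lambda>\<omega>. \<Sum>i\<in>{2..n}. w \<bullet> X i \<omega>"
    have Tm[measurable]: "?T \<in> borel_measurable M"
      by (intro borel_measurable_sum borel_measurable_inner borel_measurable_const X_measurable) auto
    have "\<P>(\<omega> in M. \<delta> * real n < - ?T \<omega>) \<le> 1 / 2"
      using K[OF n, of "{2..n}"] elim by (simp add: sum_negf)
    moreover have "\<P>(\<omega> in M. \<not> \<delta> * real n < - ?T \<omega>) = 1 - \<P>(\<omega> in M. \<delta> * real n < - ?T \<omega>)"
      by (rule prob_neg) measurable
    ultimately have rest: "1 / 2 \<le> \<P>(\<omega> in M. - (\<delta> * real n) \<le> ?T \<omega>)"
      by (simp add: not_less minus_le_iff)
    \<comment> \<open>Angle and radius are asymptotically independent: given \<open>R > y n\<close>,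
      the cap still has probability above \<open>p / 2\<close>.\<close>
    have "p / 2 * exp (- (\<kappa> * y n powr \<beta>)) \<le> \<P>(\<omega> in M. \<Theta> \<omega> \<in> S \<bar> R \<omega> > y n) * \<P>(\<omega> in M. y n < R \<omega>)"
      unfolding R_tail[OF y0] using elim by (intro mult_right_mono) auto
    also have "\<dots> = \<P>(\<omega> in M. \<Theta> \<omega> \<in> S \<and> y n < R \<omega>)"
      by (simp add: cond_prob_def R_tail[OF y0])
    also have "\<dots> \<le> \<P>(\<omega> in M. (a + \<delta>) * real n < w \<bullet> (R \<omega> *\<^sub>R \<Theta> \<omega>))"
    proof (rule finite_measure_mono)
      show "{\<omega> \<in> space M. \<Theta> \<omega> \<in> S \<and> y n < R \<omega>} \<subseteq> {\<omega> \<in> space M. (a + \<delta>) * real n < w \<bullet> (R \<omega> *\<^sub>R \<Theta> \<omega>)}"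
      proof clarify
        fix \<omega> assume "\<Theta> \<omega> \<in> S" and y: "y n < R \<omega>"
        then have "(1 - \<delta>) * A $ k $ k * D $ k $ k < \<Theta> \<omega> $ k * D $ k $ k"
          using D(2) by (intro mult_strict_right_mono) (auto simp: S_def)
        then have wS: "(1 - \<delta>) * m < w \<bullet> \<Theta> \<omega>"
          using D(1) by (simp add: w diagonal_mat_mult_component flip: D(3)) (simp add: mult_ac)
        have "(a + \<delta>) * real n = y n * ((1 - \<delta>) * m)" using \<delta> m by (simp add: y_def)
        also have "\<dots> < R \<omega> * (w \<bullet> \<Theta> \<omega>)"
          using y wS y0[of n] \<delta> m by (intro mult_strict_mono') auto
        finally show "(a + \<delta>) * real n < w \<bullet> (R \<omega> *\<^sub>R \<Theta> \<omega>)" by simp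
      qed
    qed measurable
    also have "\<dots> = \<P>(\<omega> in M. (a + \<delta>) * real n < w \<bullet> X 1 \<omega>)"
      by (rule X_prob_eq[symmetric]) auto
    finally have first: "p / 2 * exp (- (\<kappa> * y n powr \<beta>)) \<le> \<P>(\<omega> in M. (a + \<delta>) * real n < w \<bullet> X 1 \<omega>)" .
    have set: "insert 1 {2..n} = {1..n}" using n by auto
    have "indep_vars (\<lambda>_. borel) X {1..n}"
      using indep_X by (rule indep_vars_subset) auto
    then have "indep_vars (\<lambda>_. borel) (\<lambda>i \<omega>. w \<bullet> X i \<omega>) (insert 1 {2..n})"
      unfolding set by (rule indep_vars_compose2) measurable
    then have ind: "indep_var borel (\<lambda>\<omega>. w \<bullet> X 1 \<omega>) borel ?T"
      by (intro indep_vars_sum) auto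
    \<comment> \<open>The constant \<open>p / 4\<close> combines \<open>p / 2\<close> from the first
      step with 1/2 from the others, multiplied by independence.\<close>
    have "p / 4 * exp (- (\<kappa> * y n powr \<beta>)) = p / 2 * exp (- (\<kappa> * y n powr \<beta>)) * (1 / 2)" by simp
    also have "\<dots> \<le> \<P>(\<omega> in M. (a + \<delta>) * real n < w \<bullet> X 1 \<omega>) * \<P>(\<omega> in M. - (\<delta> * real n) \<le> ?T \<omega>)"
      using first rest p0 by (intro mult_mono) auto
    also have "\<dots> = prob ((\<lambda>\<omega>. (w \<bullet> X 1 \<omega>, ?T \<omega>)) -` ({(a + \<delta>) * real n<..} \<times> {- (\<delta> * real n)..}) \<inter> space M)"
      using indep_varD[OF ind, of "{(a + \<delta>) * real n<..}" "{- (\<delta> * real n)..}"]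
      by (simp add: vimage_def Int_def conj_commute)
    also have "\<dots> \<le> deviation_prob D a n"
      unfolding deviation_prob_eq[OF n]
    proof (rule finite_measure_mono)
      show "(\<lambda>\<omega>. (w \<bullet> X 1 \<omega>, ?T \<omega>)) -` ({(a + \<delta>) * real n<..} \<times> {- (\<delta> * real n)..}) \<inter> space M \<subseteq>
        {\<omega> \<in> space M. a * real n < norm (D *v random_walk X n \<omega>)}"
      proof clarsimp
        fix \<omega> assume 1: "(a + \<delta>) * real n < w \<bullet> X (Suc 0) \<omega>" and 2: "- (\<delta> * real n) \<le> ?T \<omega>"
        have "w \<bullet> random_walk X n \<omega> = w \<bullet> X 1 \<omega> + ?T \<omega>"
          unfolding random_walk_inner set[symmetric] by (subst sum.insert) auto
        then have "a * real n < w \<bullet> random_walk X n \<omega>" using 1 2 by (simp add: algebra_simps)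
        also have "\<dots> \<le> norm (D *v random_walk X n \<omega>)"
          unfolding w using component_le_norm_cart by (rule order_trans[OF abs_ge_self])
        finally show "a * real n < norm (D *v random_walk X n \<omega>)" .
      qed
      show "{\<omega> \<in> space M. a * real n < norm (D *v random_walk X n \<omega>)} \<in> sets M"
        unfolding retained_walk_def[symmetric] by measurable
    qed
    finally show ?case .
  qed
  moreover have "y n powr \<beta> = ((a + \<delta>) / ((1 - \<delta>) * m)) powr \<beta> * real n powr \<beta>" for n
    unfolding y_def using c0 by (subst powr_mult) auto
  ultimately show ?thesis using p0 by (intro exI[of _ "p / 4"]) (simp add: mult.assoc)
qed

section \<open>The exact rate\<close>

text \<open>For each fixed \<open>\<delta>\<close> the two bounds have explicit rates, which tend to
  the claimed limit as \<open>\<delta>\<close> decreases to 0. Given \<open>y\<close> on one side of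
  the limit, \<open>\<delta>\<close> is fixed first and then \<open>n\<close> grows.\<close>

lemma log_prob_ratio_tendsto:
  fixes D :: "real ^ 'n ^ 'n"
  assumes D: "diagonal_mat D" "\<And>j. 0 < D $ j $ j" and a: "0 < a"
    and m_def: "m = (MAX j. D $ j $ j * A $ j $ j)"
  shows "log_prob_ratio M (weibull_exponent \<kappa> \<beta>) (retained_walk X D) a \<longlonglongrightarrow> - ((a / m) powr \<beta>)"
proof -
  have "m \<in> range (\<lambda>j. D $ j $ j * A $ j $ j)" unfolding m_def by (rule Max_in) auto
  then obtain k where k: "D $ k $ k * A $ k $ k = m" by auto
  have m: "0 < m" using D A_pos by (simp flip: k)
  have mj: "D $ j $ j * A $ j $ j \<le> m" for j unfolding m_def by (rule Max_ge) auto
  have Dm: "norm (D *v \<theta>) \<le> m" if \<theta>: "\<theta> \<in> \<Omega>" for \<theta>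
  proof -
    obtain x where x: "\<theta> = A *v x" "norm x = 1" using \<theta> by auto
    have "norm (D *v \<theta>) \<le> norm (m *\<^sub>R x)"
    proof (rule norm_le_componentwise_cart)
      fix j
      have "\<bar>D $ j $ j\<bar> = D $ j $ j" "\<bar>A $ j $ j\<bar> = A $ j $ j"
        using D A_pos by (simp_all add: less_imp_le)
      then have "norm ((D *v \<theta>) $ j) = D $ j $ j * A $ j $ j * \<bar>x $ j\<bar>"
        using D(1) diag_A x(1) by (simp add: diagonal_mat_mult_component abs_mult flip: mult.assoc)
      also have "\<dots> \<le> m * \<bar>x $ j\<bar>" using mj by (rule mult_right_mono) simp
      finally show "norm ((D *v \<theta>) $ j) \<le> norm ((m *\<^sub>R x) $ j)"
        using m by (simp add: abs_mult)
    qed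
    then show ?thesis using m x(2) by simp
  qed
  have ratio: "log_prob_ratio M (weibull_exponent \<kappa> \<beta>) (retained_walk X D) a n =
      ln (deviation_prob D a n) / (\<kappa> * real n powr \<beta>)" for n
    by (simp add: log_prob_ratio_def deviation_prob_def weibull_exponent_def)
  have small: "\<forall>\<^sub>F \<delta> :: real in at_right 0. \<delta> \<in> {0<..<1}"
    by (rule eventually_at_right_real) simp
  \<comment> \<open>The upper estimate may be passed through the logarithm only where the
    probability is positive; the lower bound with the arbitrary value 1/2 for
    \<open>\<delta>\<close> ensures this eventually.\<close>
  have pos: "\<forall>\<^sub>F n in sequentially. 0 < deviation_prob D a n"
  proof -
    obtain p where p: "0 < p" "\<forall>\<^sub>F n in sequentially.
      p * exp (- (\<kappa> * ((a + 1 / 2) / ((1 - 1 / 2) * m)) powr \<beta> * real n powr \<beta>)) \<le> deviation_prob D a n"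
      using deviation_prob_lower[OF D k m Dm, of "1 / 2" a] a by auto
    from p(2) show ?thesis
      by eventually_elim (rule less_le_trans, use p(1) in auto)
  qed
  show ?thesis
  proof (rule order_tendstoI)
    fix y assume y: "y < - ((a / m) powr \<beta>)"
    have "((\<lambda>\<delta>. - (((a + \<delta>) / ((1 - \<delta>) * m)) powr \<beta>)) \<longlongrightarrow> - (((a + 0) / ((1 - 0) * m)) powr \<beta>)) (at_right 0)"
      using a m by (intro tendsto_intros) auto
    then have "\<forall>\<^sub>F \<delta> in at_right 0. y < - (((a + \<delta>) / ((1 - \<delta>) * m)) powr \<beta>)"
      using y by (intro order_tendstoD) auto
    with small have "\<forall>\<^sub>F \<delta> in at_right 0. \<delta> \<in> {0<..<1} \<and> y < - (((a + \<delta>) / ((1 - \<delta>) * m)) powr \<beta>)"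
      by (rule eventually_conj)
    from eventually_happens'[OF trivial_limit_at_right_real this]
    obtain \<delta> where \<delta>: "0 < \<delta>" "\<delta> < 1" and yd: "y < - (((a + \<delta>) / ((1 - \<delta>) * m)) powr \<beta>)"
      by auto
    define r where "r = ((a + \<delta>) / ((1 - \<delta>) * m)) powr \<beta>"
    obtain p where p: "0 < p" and low: "\<forall>\<^sub>F n in sequentially.
      p * exp (- (\<kappa> * r * real n powr \<beta>)) \<le> deviation_prob D a n"
      using deviation_prob_lower[OF D k m Dm \<delta> a] unfolding r_def by auto
    have "\<forall>\<^sub>F n in sequentially. y < ln p / (\<kappa> * real n powr \<beta>) - r"
      using lower_rate_limit[OF \<beta>(1) \<kappa>] yd by (intro order_tendstoD) (auto simp: r_def)
    with low eventually_gt_at_top[of 0] show "\<forall>\<^sub>F n in sequentially.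
      y < log_prob_ratio M (weibull_exponent \<kappa> \<beta>) (retained_walk X D) a n"
    proof eventually_elim
      case (elim n)
      have "ln p - \<kappa> * r * real n powr \<beta> = ln (p * exp (- (\<kappa> * r * real n powr \<beta>)))"
        using p by (simp add: ln_mult)
      also have "\<dots> \<le> ln (deviation_prob D a n)"
        using elim p by (subst ln_le_cancel_iff) (auto intro: less_le_trans[rotated])
      finally have "(ln p - \<kappa> * r * real n powr \<beta>) / (\<kappa> * real n powr \<beta>) \<le> ln (deviation_prob D a n) / (\<kappa> * real n powr \<beta>)"
        using \<kappa> by (intro divide_right_mono) auto
      moreover have "(ln p - \<kappa> * r * real n powr \<beta>) / (\<kappa> * real n powr \<beta>) = ln p / (\<kappa> * real n powr \<beta>) - r"
        using \<kappa> elim by (simp add: diff_divide_distrib)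
      ultimately show ?case using elim unfolding ratio by simp
    qed
  next
    fix y assume y: "- ((a / m) powr \<beta>) < y"
    have "((\<lambda>\<delta>. - ((1 - \<delta>) * ((1 - \<delta>) * a / m) powr \<beta>)) \<longlongrightarrow> - ((1 - 0) * ((1 - 0) * a / m) powr \<beta>)) (at_right 0)"
      using a m by (intro tendsto_intros) auto
    then have "\<forall>\<^sub>F \<delta> in at_right 0. - ((1 - \<delta>) * ((1 - \<delta>) * a / m) powr \<beta>) < y"
      using y by (intro order_tendstoD) auto
    with small have "\<forall>\<^sub>F \<delta> in at_right 0. \<delta> \<in> {0<..<1} \<and> - ((1 - \<delta>) * ((1 - \<delta>) * a / m) powr \<beta>) < y"
      by (rule eventually_conj)
    from eventually_happens'[OF trivial_limit_at_right_real this]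
    obtain \<delta> where \<delta>: "0 < \<delta>" "\<delta> < 1" and yd: "- ((1 - \<delta>) * ((1 - \<delta>) * a / m) powr \<beta>) < y"
      by auto
    define r where "r = (1 - \<delta>) * ((1 - \<delta>) * a / m) powr \<beta>"
    \<comment> \<open>Tying the exponential parameter to \<open>\<delta>\<close> lets one limit
      remove both losses, the one in the direction and the one in the exponent.\<close>
    have s: "0 < (1 - \<delta>) * \<kappa>" "(1 - \<delta>) * \<kappa> < \<kappa>" using \<delta> \<kappa> by auto
    obtain N K where N: "0 < N" and up: "\<And>n. 1 \<le> n \<Longrightarrow> deviation_prob D a n \<le>
        N * (real n + 1) * exp (real n powr \<beta> * (K * real n powr (\<beta> - 1) - \<kappa> * r))"
      using deviation_prob_upper[OF m Dm s \<delta> a] unfolding r_def by (auto simp: mult_ac)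
    have "\<forall>\<^sub>F n in sequentially.
      (ln (N * (real n + 1)) + real n powr \<beta> * (K * real n powr (\<beta> - 1) - \<kappa> * r)) / (\<kappa> * real n powr \<beta>) < y"
      using upper_rate_limit[OF \<beta> \<kappa> N] yd by (intro order_tendstoD) (auto simp: r_def)
    with pos eventually_ge_at_top[of 1] show "\<forall>\<^sub>F n in sequentially.
      log_prob_ratio M (weibull_exponent \<kappa> \<beta>) (retained_walk X D) a n < y"
    proof eventually_elim
      case (elim n)
      let ?E = "real n powr \<beta> * (K * real n powr (\<beta> - 1) - \<kappa> * r)"
      have "ln (deviation_prob D a n) \<le> ln (N * (real n + 1) * exp ?E)"
        using elim up[of n] N by (subst ln_le_cancel_iff) auto
      also have "\<dots> = ln (N * (real n + 1)) + ?E"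
        using N by (subst ln_mult) auto
      finally have "ln (deviation_prob D a n) / (\<kappa> * real n powr \<beta>) \<le> (ln (N * (real n + 1)) + ?E) / (\<kappa> * real n powr \<beta>)"
        using \<kappa> by (intro divide_right_mono) auto
      then show ?case using elim unfolding ratio by simp
    qed
  qed
qed

end

section \<open>Minimisation over the strategies\<close>

text \<open>\<open>matrix_inv\<close> is a choice among two-sided inverses: exhibiting one makes the
  choice proper, and uniqueness of inverses identifies it.\<close>

lemma matrix_inv_diagonal:
  fixes A :: "real ^ 'n ^ 'n::finite"
  assumes A: "diagonal_mat A" "\<And>k. A $ k $ k \<noteq> 0"
  shows "matrix_inv A = (\<chi> i j. if i = j then 1 / A $ i $ i else 0)"
proof -
  let ?B = "\<chi> i j. if i = j then 1 / A $ i $ i else 0"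
  have "(A ** ?B) $ i $ j = (mat 1 :: real ^ 'n ^ 'n) $ i $ j" for i j
  proof -
    have "(A ** ?B) $ i $ j = (\<Sum>k\<in>UNIV. if k = j then A $ i $ k * (1 / A $ k $ k) else 0)"
      by (simp add: matrix_matrix_mult_def if_distrib cong: if_cong)
    also have "\<dots> = A $ i $ j * (1 / A $ j $ j)" by simp
    finally show ?thesis using A by (auto simp: mat_def diagonal_mat_def)
  qed
  then have AB: "A ** ?B = mat 1" by (simp add: vec_eq_iff)
  then have BA: "?B ** A = mat 1" by (simp add: matrix_left_right_inverse)
  have "matrix_inv A ** A = mat 1"
    unfolding matrix_inv_def
    using someI[of "\<lambda>B. A ** B = mat 1 \<and> B ** A = mat 1", OF conjI[OF AB BA]] by simp
  then have "matrix_inv A = matrix_inv A ** (A ** ?B)" by (simp add: AB)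
  also have "\<dots> = ?B" using \<open>matrix_inv A ** A = mat 1\<close> by (simp add: matrix_mul_assoc)
  finally show ?thesis .
qed

theorem theorem4p2:
  fixes M :: "'a measure"
    and R :: "'a \<Rightarrow> real"
    and \<Theta> :: "'a \<Rightarrow> real ^ 'n::finite"
    and X :: "nat \<Rightarrow> 'a \<Rightarrow> real ^ 'n"
    and A Q :: "real ^ 'n ^ 'n"
    and p :: "real ^ 'n"
    and \<kappa> \<beta> a :: real
    and h :: "real \<Rightarrow> real"
  assumes "prob_space M"
    and "0 < \<beta>" and "\<beta> < 1" and "0 < \<kappa>"
    and "weibull_distributed M \<kappa> \<beta> R"
    and "diagonal_mat A" and "\<forall>k. 0 < A $ k $ k"
    and "angular_assumption M R \<Theta> ((\<lambda>x. A *v x) ` sphere 0 1)"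
    and "prob_space.indep_vars M (\<lambda>_. borel) X {1..}"
    and "\<forall>i\<ge>1. distr M borel (X i) = distr M borel (\<lambda>\<omega>. R \<omega> *\<^sub>R \<Theta> \<omega>)"
    and "\<forall>j. 0 < p $ j"
    and "0 < a"
    and h_eq: "h = weibull_exponent \<kappa> \<beta>"
    and Q_eq: "Q = (MIN j. A $ j $ j) *\<^sub>R matrix_inv A"
  shows "convergent (log_prob_ratio M h (random_walk X) a) \<and>
    (\<forall>Q' \<in> quota_share_strategies. convergent (log_prob_ratio M h (retained_walk X Q') a)) \<and>
    log_prob_rate M h (random_walk X) a \<ge> log_prob_rate M h (retained_walk X Q) a \<and>
    rate_minimising_strategy M h X a Q \<and>
    (\<forall>Q'. is_arg_min (premium p) (rate_minimising_strategy M h X a) Q' \<longleftrightarrow> Q' = Q)"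
proof -
  interpret heavy_tailed_walk M R \<Theta> X A \<kappa> \<beta>
    by (intro heavy_tailed_walk.intro heavy_tailed_walk_axioms.intro assms)
  let ?S = "quota_share_strategies :: (real ^ 'n ^ 'n) set"
  define \<mu> where "\<mu> D = (MAX j. D $ j $ j * A $ j $ j)" for D :: "real ^ 'n ^ 'n"
  define \<rho> where "\<rho> D = log_prob_rate M h (retained_walk X D) a" for D
  define b where "b = (MIN j. A $ j $ j)"
  have b_le: "b \<le> A $ j $ j" for j by (simp add: b_def)
  have "b \<in> range (\<lambda>j. A $ j $ j)" unfolding b_def by (rule Min_in) auto
  then obtain k where k: "b = A $ k $ k" by auto
  have b0: "0 < b" using A_pos k by simp
  have A0: "A $ j $ j \<noteq> 0" for j using A_pos by (metis less_irrefl)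
  have Q: "Q $ i $ j = (if i = j then b / A $ i $ i else 0)" for i j
    using diag_A A0 by (simp add: Q_eq matrix_inv_diagonal flip: b_def)
  have QS: "Q \<in> ?S"
    using b0 b_le A_pos A0 k by (auto simp: quota_share_strategies_def diagonal_mat_def Q)
  \<comment> \<open>\<open>Q\<close> maps the ellipsoid to a sphere of radius \<open>b\<close>: all
    products of diagonal entries of \<open>Q\<close> and \<open>A\<close> are equal.\<close>
  have \<mu>Q: "\<mu> Q = b" using A0 by (simp add: \<mu>_def Q)
  have lim: "log_prob_ratio M h (retained_walk X D) a \<longlonglongrightarrow> - ((a / \<mu> D) powr \<beta>)" if "D \<in> ?S" for D
    unfolding h_eq using that \<open>0 < a\<close> by (intro log_prob_ratio_tendsto) (auto simp: quota_share_strategies_def \<mu>_def)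
  have \<rho>: "\<rho> D = - ((a / \<mu> D) powr \<beta>)" if "D \<in> ?S" for D
    unfolding \<rho>_def log_prob_rate_def using lim[OF that] by (rule limI)
  have \<mu>_ge: "b \<le> \<mu> D" if D: "D \<in> ?S" for D
  proof -
    obtain i where "D $ i $ i = 1" using D by (auto simp: quota_share_strategies_def)
    then have "b \<le> D $ i $ i * A $ i $ i" using b_le by simp
    also have "\<dots> \<le> \<mu> D" unfolding \<mu>_def by (rule Max_ge) auto
    finally show ?thesis .
  qed
  have \<rho>_mono: "\<rho> Q \<le> \<rho> D" and \<rho>_strict: "\<rho> D \<le> \<rho> Q \<Longrightarrow> \<mu> D = b" if D: "D \<in> ?S" for D
  proof -
    have "a / \<mu> D \<le> a / b" using \<mu>_ge[OF D] b0 \<open>0 < a\<close> by (intro divide_left_mono) auto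
    then show "\<rho> Q \<le> \<rho> D"
      using \<rho>[OF D] \<rho>[OF QS] \<mu>Q \<mu>_ge[OF D] b0 \<open>0 < a\<close> \<beta> by (simp add: powr_mono2)
    assume "\<rho> D \<le> \<rho> Q"
    show "\<mu> D = b"
    proof (rule ccontr)
      assume "\<mu> D \<noteq> b"
      then have "a / \<mu> D < a / b" using \<mu>_ge[OF D] b0 \<open>0 < a\<close> by (intro divide_strict_left_mono) auto
      then have "(a / \<mu> D) powr \<beta> < (a / b) powr \<beta>"
        using \<mu>_ge[OF D] b0 \<open>0 < a\<close> \<beta> by (intro powr_less_mono2) auto
      then show False using \<open>\<rho> D \<le> \<rho> Q\<close> \<rho>[OF D] \<rho>[OF QS] \<mu>Q by simp
    qed
  qed
  \<comment> \<open>Since \<open>\<rho> Q\<close> is least, being a minimiser reduces to a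
    comparison with \<open>Q\<close> alone.\<close>
  have minimising: "rate_minimising_strategy M h X a D \<longleftrightarrow> D \<in> ?S \<and> \<rho> D \<le> \<rho> Q" for D
    unfolding rate_minimising_strategy_def is_arg_min_def \<rho>_def[symmetric]
    using QS \<rho>_mono by (meson le_less_trans not_less)
  \<comment> \<open>The walk without reinsurance belongs to the identity matrix, itself a strategy,
    so its convergence and the inequality with \<open>Q\<close> are instances of the results for
    strategies.\<close>
  have walk: "random_walk X = retained_walk X (mat 1)"
    by (simp add: fun_eq_iff retained_walk_def)
  have oneS: "mat 1 \<in> ?S"
    by (simp add: quota_share_strategies_def diagonal_mat_def mat_def)
  \<comment> \<open>Among the minimisers \<open>Q\<close> retains the largest share of every
    component, hence cedes the least.\<close>
  have entry_le: "D $ j $ j \<le> Q $ j $ j" if "D \<in> ?S" "\<mu> D = b" for D j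
  proof -
    have "D $ j $ j * A $ j $ j \<le> b" unfolding that(2)[symmetric] \<mu>_def by (rule Max_ge) auto
    then show ?thesis using A_pos by (simp add: Q field_simps)
  qed
  have premium_le: "premium p Q \<le> premium p D" and premium_eq: "premium p D \<le> premium p Q \<Longrightarrow> D = Q"
    if D: "rate_minimising_strategy M h X a D" for D
  proof -
    have DS: "D \<in> ?S" and \<mu>D: "\<mu> D = b" using D \<rho>_strict by (auto simp: minimising)
    have le: "(1 - Q $ j $ j) * p $ j \<le> (1 - D $ j $ j) * p $ j" for j
      using entry_le[OF DS \<mu>D, of j] \<open>\<forall>j. 0 < p $ j\<close> by (intro mult_right_mono) (auto simp: less_imp_le)
    then show "premium p Q \<le> premium p D" unfolding premium_def by (intro sum_mono)
    assume prem: "premium p D \<le> premium p Q"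
    \<comment> \<open>All prices are positive, so a single smaller share would raise the premium
      strictly.\<close>
    have "D $ j $ j = Q $ j $ j" for j
    proof (rule ccontr)
      assume "D $ j $ j \<noteq> Q $ j $ j"
      then have "(1 - Q $ j $ j) * p $ j < (1 - D $ j $ j) * p $ j"
        using entry_le[OF DS \<mu>D, of j] \<open>\<forall>j. 0 < p $ j\<close> by (intro mult_strict_right_mono) auto
      then have "premium p Q < premium p D"
        unfolding premium_def using le by (intro sum_strict_mono_ex1) auto
      then show False using prem by simp
    qed
    moreover have "D $ i $ j = Q $ i $ j" if "i \<noteq> j" for i j
      using that DS QS by (simp add: quota_share_strategies_def diagonal_mat_def)
    ultimately show "D = Q" unfolding vec_eq_iff by metis
  qed
  show ?thesis
  proof (intro conjI ballI allI)
    show "convergent (log_prob_ratio M h (random_walk X) a)"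
      unfolding walk using lim[OF oneS] by (rule convergentI)
    show "convergent (log_prob_ratio M h (retained_walk X Q') a)" if "Q' \<in> ?S" for Q'
      using lim[OF that] by (rule convergentI)
    show "log_prob_rate M h (retained_walk X Q) a \<le> log_prob_rate M h (random_walk X) a"
      unfolding walk using \<rho>_mono[OF oneS] by (simp add: \<rho>_def)
    show min_Q: "rate_minimising_strategy M h X a Q"
      using QS by (simp add: minimising)
    show "is_arg_min (premium p) (rate_minimising_strategy M h X a) Q' \<longleftrightarrow> Q' = Q" for Q'
      unfolding is_arg_min_def using min_Q premium_le premium_eq by (meson leD leI)
  qed
qed

end
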